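(* Let $T_{\min}>0$, let each $S_i$ ($i=1,\dots,N$) be exponentially stable, and let the growth condition for the lifted system (defined in the context) hold over $\Sigma_{\min}(T_{\min})$. The following statements are equivalent: (i) the switched system $\dot x(t)=A_{\eta(t)}x(t)$ is UGES over $\Sigma_{\min}(T_{\min})$; (ii) there exist $p\ge1$, $c>0$ and mode-dependent timer functionals $\bar V_i:[0,T_{\min}]\times X\to\mathbb R_{\ge0}$, $i=1,\dots,N$, each Lipschitz on bounded subsets of $X$ uniformly in $\tau$ and continuous in $\tau$, extended by $\bar V_i(\tau,\cdot):=\bar V_i(T_{\min},\cdot)$ for $\tau\ge T_{\min}$, such that for all $x\in X$, every mode $i$ and every $j\ne i$, $$\bar V_i(\tau,x)\le c\|x\|^p,\quad\tau\in[0,T_{\min}],\qquad \underline D^+_i\bar V_i(\tau,x)\le-\|x\|^p,\quad\tau\in[0,T_{\min}],\qquad \bar V_j(0,x)\le\bar V_i(T_{\min},x).$$ An explicit witness for (ii) (when (i) holds) is $$\bar V_i(\tau,x):=\sup_{\eta\in\Sigma_i^{(\tau)}}\int_0^\infty\|\Phi_\eta(s,0)x\|^p\,ds,$$ where $\Sigma_i^{(\tau)}$ is the set of admissible future signals starting in mode $i$ with elapsed dwell $\tau$: the first switch occurs no earlier than $\max(T_{\min}-\tau,0)$ and consecutive subsequent switches are at least $T_{\min}$ apart.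
   Context: Switched system. $X$ is a Banach space with norm $\|\cdot\|$; $A_1,\dots,A_N$ generate $C_0$-semigroups $S_1,\dots,S_N$ on $X$ and share a common domain $\mathcal D=D(A_1)=\dots=D(A_N)$. A switching signal $\eta:\mathbb R_{\ge0}\to\{1,\dots,N\}$ is piecewise constant and right-continuous; its discontinuities (switching instants) form a sequence $\{t_k\}_{k\ge1}$ with, setting $t_0:=0$, $t_{k+1}>t_k$ for $k\ge0$ and $t_k\to\infty$; $\eta\equiv i_k$ on $[t_k,t_{k+1})$ with $i_{k-1}\neq i_k$. $\Phi_\eta(t,s)$, $t\ge s\ge0$, is the evolution family of $\dot x=A_{\eta(t)}x$: it coincides with the active semigroup on each mode interval and is composed continuously across switches, i.e. $\Phi_\eta(t,s)=S_{i_m}(t-t_m)S_{i_{m-1}}(t_m-t_{m-1})\cdots S_{i_{l-1}}(t_l-s)$ if $t_l<\dots<t_m$ are the switching instants in $(s,t]$. $\Sigma_{\min}(T_{\min})$ is the family of switching signals whose consecutive switching instants are at least $T_{\min}$ apart. UGES over a family $\Sigma$ of signals: there exist $M\ge1$, $\alpha\ge0$, $\rho\in(0,1]$ with $\alpha-\log\rho>0$ such that $\|\Phi_\eta(t,s)\|\le M\rho^{\kappa(t,s)}e^{-\alpha(t-s)}$ for all $t\ge s\ge0$ and $\eta\in\Sigma$, where $\kappa(t,s)$ is the number of switching instants of $\eta$ in $(s,t]$. Lifted system. On $\mathcal X:=X^N$ with norm $(\sum_i\|z_i\|^p)^{1/p}$ for some $p\ge1$, let $\mathcal S(t)=\mathrm{diag}(S_1(t),\dots,S_N(t))$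 and, for $i\ne j$, let $J_{ij}$ be the selector $(J_{ij}z)_j=z_i$, $(J_{ij}z)_l=0$ for $l\neq j$. For a signal $\eta$, $U_\eta(t,s)$ is the propagator on $\mathcal X$ that follows $\mathcal S$ between switching instants and applies $J_{i_{k-1}i_k}$ at $t_k$. Growth condition for the lifted system: there exist a piecewise continuous $g:\mathbb R_{\ge0}\to\mathbb R_{>0}$ bounded below by some $c_0>0$, and $\mu>1$, with $\|U_\eta(t,s)z\|\le g(t-s)\mu^{\kappa(t,s)}\|z\|$ for all $t\ge s\ge0$, $z\in\mathcal X$, $\eta\in\Sigma_{\min}(T_{\min})$, and $\sup_{\tau\ge0}g(\tau)<\infty$. Functionals. $\bar V_i$ is Lipschitz on bounded subsets uniformly in $\tau$ if for every $r>0$ there is $L_r>0$ with $|\bar V_i(\tau,x)-\bar V_i(\tau,y)|\le L_r\|x-y\|$ for all $\|x\|,\|y\|<r$ and all $\tau$. $\underline D^+_i\bar V_i(\tau,x):=\liminf_{h\downarrow0}h^{-1}\big(\bar V_i(\tau+h,S_i(h)x)-\bar V_i(\tau,x)\big)$. *)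

theory Defs
  imports "HOL-Analysis.Analysis"
begin

text \<open>
  The Banach space \<open>X\<close> is the type \<open>'a\<close>; the modes \<open>1, \<dots>, N\<close> are the elements of a
  finite type \<open>'n\<close>, so that \<open>N = CARD('n) \<ge> 1\<close>. Functions on the half-line \<open>[0, \<infinity>)\<close> are
  functions on \<^typ>\<open>real\<close> whose values at negative arguments are never used.
\<close>

definition C0_semigroup :: "(real \<Rightarrow> 'a::banach \<Rightarrow>\<^sub>L 'a) \<Rightarrow> bool" where
  "C0_semigroup S \<longleftrightarrow>
     S 0 = id_blinfun \<and>
     (\<forall>s\<ge>0. \<forall>t\<ge>0. S (s + t) = S s o\<^sub>L S t) \<and>
     (\<forall>x. ((\<lambda>t. S t x) \<longlongrightarrow> x) (at_right 0))"

text \<open>\<open>generates D A S\<close>: the operator \<open>A\<close> with domain \<open>D\<close> (its values outside \<open>D\<close> are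
  irrelevant) is the infinitesimal generator of the \<open>C\<^sub>0\<close>-semigroup \<open>S\<close>.\<close>

definition generates :: "'a::banach set \<Rightarrow> ('a \<Rightarrow> 'a) \<Rightarrow> (real \<Rightarrow> 'a \<Rightarrow>\<^sub>L 'a) \<Rightarrow> bool" where
  "generates D A S \<longleftrightarrow>
     C0_semigroup S \<and>
     D = {x. \<exists>y. ((\<lambda>h. (S h x - x) /\<^sub>R h) \<longlongrightarrow> y) (at_right 0)} \<and>
     (\<forall>x\<in>D. ((\<lambda>h. (S h x - x) /\<^sub>R h) \<longlongrightarrow> A x) (at_right 0))"

definition exponentially_stable :: "(real \<Rightarrow> 'a::banach \<Rightarrow>\<^sub>L 'a) \<Rightarrow> bool" where
  "exponentially_stable S \<longleftrightarrow>
     (\<exists>M\<ge>1. \<exists>\<omega>>0. \<forall>t\<ge>0. norm (S t) \<le> M * exp (- \<omega> * t))"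

text \<open>The discontinuities of a right-continuous signal (the mode set being discrete).
  The initial time \<open>0\<close> is not a switching instant.\<close>

definition switching_instants :: "(real \<Rightarrow> 'n) \<Rightarrow> real set" where
  "switching_instants \<eta> = {t. 0 < t \<and> \<not> (\<forall>\<^sub>F s in at_left t. \<eta> s = \<eta> t)}"

text \<open>Local finiteness says that the switching instants can be enumerated in strictly
  increasing order and, if there are infinitely many of them, tend to infinity; with right
  continuity it makes the signal constant between consecutive ones. Signals with finitely many
  switches, in particular constant ones, are included (so the signal classes are nonempty
  also for \<open>N = 1\<close>).\<close>

definition switching_signal :: "(real \<Rightarrow> 'n::finite) \<Rightarrow> bool" where
  "switching_signal \<eta> \<longleftrightarrow>
     (\<forall>t\<ge>0. \<forall>\<^sub>F s in at_right t. \<eta> s = \<eta> t) \<and>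
     (\<forall>b. finite (switching_instants \<eta> \<inter> {0..b}))"

definition switch_count :: "(real \<Rightarrow> 'n) \<Rightarrow> real \<Rightarrow> real \<Rightarrow> nat" where
  "switch_count \<eta> t s = card (switching_instants \<eta> \<inter> {s<..t})"

definition dwell_at_least :: "real \<Rightarrow> (real \<Rightarrow> 'n) \<Rightarrow> bool" where
  "dwell_at_least T \<eta> \<longleftrightarrow>
     (\<forall>r\<in>switching_instants \<eta>. \<forall>r'\<in>switching_instants \<eta>. r < r' \<longrightarrow> T \<le> r' - r)"

definition Sigma_min :: "real \<Rightarrow> (real \<Rightarrow> 'n::finite) set" where
  "Sigma_min T = {\<eta>. switching_signal \<eta> \<and> dwell_at_least T \<eta>}"

text \<open>\<open>\<Sigma>\<^sub>i\<^sup>(\<^sup>\<tau>\<^sup>)\<close>: admissible future signals starting in mode \<open>i\<close> with elapsed dwell \<open>\<tau>\<close>.\<close>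

definition Sigma_future :: "real \<Rightarrow> 'n::finite \<Rightarrow> real \<Rightarrow> (real \<Rightarrow> 'n) set" where
  "Sigma_future T i \<tau> =
     {\<eta>. switching_signal \<eta> \<and> \<eta> 0 = i \<and>
         (\<forall>r\<in>switching_instants \<eta>. max (T - \<tau>) 0 \<le> r) \<and> dwell_at_least T \<eta>}"

text \<open>The last argument of \<open>switched_product\<close> lists the switching instants in \<open>(s,t]\<close>
  increasingly; the mode active from \<open>s\<close> up to the next switching instant is \<open>\<eta> s\<close>.\<close>

fun switched_product ::
  "('n \<Rightarrow> real \<Rightarrow> 'a::banach \<Rightarrow>\<^sub>L 'a) \<Rightarrow> (real \<Rightarrow> 'n) \<Rightarrow> real \<Rightarrow> real \<Rightarrow> real list \<Rightarrow> 'a \<Rightarrow>\<^sub>L 'a"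
where
  "switched_product S \<eta> t s [] = S (\<eta> s) (t - s)"
| "switched_product S \<eta> t s (r # rs) = switched_product S \<eta> t r rs o\<^sub>L S (\<eta> s) (r - s)"

definition evolution ::
  "('n \<Rightarrow> real \<Rightarrow> 'a::banach \<Rightarrow>\<^sub>L 'a) \<Rightarrow> (real \<Rightarrow> 'n) \<Rightarrow> real \<Rightarrow> real \<Rightarrow> 'a \<Rightarrow>\<^sub>L 'a" where
  "evolution S \<eta> t s =
     switched_product S \<eta> t s (sorted_list_of_set (switching_instants \<eta> \<inter> {s<..t}))"

definition UGES ::
  "('n \<Rightarrow> real \<Rightarrow> 'a::banach \<Rightarrow>\<^sub>L 'a) \<Rightarrow> (real \<Rightarrow> 'n) set \<Rightarrow> bool" where
  "UGES S \<Sigma> \<longleftrightarrow>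
     (\<exists>M \<alpha> \<rho>. M \<ge> 1 \<and> \<alpha> \<ge> 0 \<and> 0 < \<rho> \<and> \<rho> \<le> 1 \<and> \<alpha> - ln \<rho> > 0 \<and>
        (\<forall>\<eta>\<in>\<Sigma>. \<forall>s t. 0 \<le> s \<and> s \<le> t \<longrightarrow>
           norm (evolution S \<eta> t s) \<le> M * \<rho> ^ switch_count \<eta> t s * exp (- \<alpha> * (t - s))))"

text \<open>\<open>'a ^ 'n\<close> serves only as the product vector space \<open>X\<^sup>N\<close>; its library norm (the
  case \<open>q = 2\<close>) is replaced by the general \<open>\<ell>\<^sup>q\<close> norm.\<close>

definition lifted_norm :: "real \<Rightarrow> 'a::banach ^ 'n::finite \<Rightarrow> real" where
  "lifted_norm q z = (\<Sum>i\<in>UNIV. norm (z $ i) powr q) powr (1 / q)"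

definition lifted_semigroup ::
  "('n::finite \<Rightarrow> real \<Rightarrow> 'a::banach \<Rightarrow>\<^sub>L 'a) \<Rightarrow> real \<Rightarrow> 'a ^ 'n \<Rightarrow> 'a ^ 'n" where
  "lifted_semigroup S t z = (\<chi> i. S i t (z $ i))"

definition selector :: "'n::finite \<Rightarrow> 'n \<Rightarrow> 'a::banach ^ 'n \<Rightarrow> 'a ^ 'n" where
  "selector i j z = (\<chi> l. if l = j then z $ i else 0)"

text \<open>At a switching instant \<open>r\<close> from mode \<open>\<eta> s\<close> to mode \<open>\<eta> r\<close> the jump is
  \<open>selector (\<eta> s) (\<eta> r)\<close>; a switching instant equal to \<open>t\<close> is included.\<close>

fun lifted_product ::
  "('n::finite \<Rightarrow> real \<Rightarrow> 'a::banach \<Rightarrow>\<^sub>L 'a) \<Rightarrow> (real \<Rightarrow> 'n) \<Rightarrow> real \<Rightarrow> real \<Rightarrow> real list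
     \<Rightarrow> 'a ^ 'n \<Rightarrow> 'a ^ 'n"
where
  "lifted_product S \<eta> t s [] z = lifted_semigroup S (t - s) z"
| "lifted_product S \<eta> t s (r # rs) z =
     lifted_product S \<eta> t r rs (selector (\<eta> s) (\<eta> r) (lifted_semigroup S (r - s) z))"

definition lifted_propagator ::
  "('n::finite \<Rightarrow> real \<Rightarrow> 'a::banach \<Rightarrow>\<^sub>L 'a) \<Rightarrow> (real \<Rightarrow> 'n) \<Rightarrow> real \<Rightarrow> real
     \<Rightarrow> 'a ^ 'n \<Rightarrow> 'a ^ 'n" where
  "lifted_propagator S \<eta> t s =
     lifted_product S \<eta> t s (sorted_list_of_set (switching_instants \<eta> \<inter> {s<..t}))"

text \<open>Piecewise continuity on \<open>[0,\<infinity>)\<close>: finitely many discontinuities in each bounded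
  interval, all of them with finite one-sided limits.\<close>

definition piecewise_continuous :: "(real \<Rightarrow> real) \<Rightarrow> bool" where
  "piecewise_continuous g \<longleftrightarrow>
     (\<forall>b. finite {t \<in> {0..b}. \<not> continuous (at t within {0..}) g}) \<and>
     (\<forall>t\<ge>0. \<exists>l. (g \<longlongrightarrow> l) (at_right t)) \<and>
     (\<forall>t>0. \<exists>l. (g \<longlongrightarrow> l) (at_left t))"

definition lifted_growth ::
  "real \<Rightarrow> ('n::finite \<Rightarrow> real \<Rightarrow> 'a::banach \<Rightarrow>\<^sub>L 'a) \<Rightarrow> (real \<Rightarrow> 'n) set \<Rightarrow> bool" where
  "lifted_growth q S \<Sigma> \<longleftrightarrow>
     (\<exists>g \<mu> c0. piecewise_continuous g \<and> c0 > 0 \<and> (\<forall>\<tau>\<ge>0. c0 \<le> g \<tau>) \<and>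
        bdd_above (g ` {0..}) \<and> \<mu> > 1 \<and>
        (\<forall>\<eta>\<in>\<Sigma>. \<forall>s t z. 0 \<le> s \<and> s \<le> t \<longrightarrow>
           lifted_norm q (lifted_propagator S \<eta> t s z)
             \<le> g (t - s) * \<mu> ^ switch_count \<eta> t s * lifted_norm q z))"

text \<open>Constant extension of a functional given on \<open>[0,T] \<times> X\<close> to \<open>\<tau> \<ge> T\<close>.\<close>

definition timer_extend :: "real \<Rightarrow> (real \<Rightarrow> 'a \<Rightarrow> real) \<Rightarrow> real \<Rightarrow> 'a \<Rightarrow> real" where
  "timer_extend T V \<tau> x = V (min \<tau> T) x"

text \<open>The lower right Dini derivative along the flow of a single mode; extended real, since
  the lower limit may be infinite.\<close>

definition lower_dini ::
  "(real \<Rightarrow> 'a::banach \<Rightarrow>\<^sub>L 'a) \<Rightarrow> (real \<Rightarrow> 'a \<Rightarrow> real) \<Rightarrow> real \<Rightarrow> 'a \<Rightarrow> ereal" where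
  "lower_dini S V \<tau> x = Liminf (at_right 0) (\<lambda>h. ereal ((V (\<tau> + h) (S h x) - V \<tau> x) / h))"

text \<open>The constraints on \<open>V i\<close> only concern its values on \<open>[0,T] \<times> X\<close>.\<close>

definition timer_functionals ::
  "('n \<Rightarrow> real \<Rightarrow> 'a::banach \<Rightarrow>\<^sub>L 'a) \<Rightarrow> real \<Rightarrow> real \<Rightarrow> real \<Rightarrow> ('n \<Rightarrow> real \<Rightarrow> 'a \<Rightarrow> real) \<Rightarrow> bool"
where
  "timer_functionals S T p c V \<longleftrightarrow>
     (\<forall>i. \<forall>\<tau>\<in>{0..T}. \<forall>x. 0 \<le> V i \<tau> x) \<and>
     (\<forall>i. \<forall>r>0. \<exists>L>0. \<forall>\<tau>\<in>{0..T}. \<forall>x y. norm x < r \<and> norm y < r \<longrightarrow>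
        \<bar>V i \<tau> x - V i \<tau> y\<bar> \<le> L * norm (x - y)) \<and>
     (\<forall>i x. continuous_on {0..T} (\<lambda>\<tau>. V i \<tau> x)) \<and>
     (\<forall>i. \<forall>\<tau>\<in>{0..T}. \<forall>x. V i \<tau> x \<le> c * norm x powr p) \<and>
     (\<forall>i. \<forall>\<tau>\<in>{0..T}. \<forall>x. lower_dini (S i) (timer_extend T (V i)) \<tau> x \<le> ereal (- (norm x powr p))) \<and>
     (\<forall>i j x. j \<noteq> i \<longrightarrow> V j 0 x \<le> V i T x)"

definition witness_functional ::
  "('n::finite \<Rightarrow> real \<Rightarrow> 'a::banach \<Rightarrow>\<^sub>L 'a) \<Rightarrow> real \<Rightarrow> real \<Rightarrow> 'n \<Rightarrow> real \<Rightarrow> 'a \<Rightarrow> ennreal" where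
  "witness_functional S T p i \<tau> x =
     (SUP \<eta>\<in>Sigma_future T i \<tau>.
        \<integral>\<^sup>+ s\<in>{0..}. ennreal (norm (evolution S \<eta> s 0 x) powr p) \<partial>lborel)"

end

theory Submission
  imports Defs
begin

text \<open>
  Both directions pass through uniform exponential stability: a bound
  \<open>norm (evolution S \<eta> t s) \<le> K * exp (- \<beta> * (t - s))\<close> with the same \<open>K\<close> and \<open>\<beta> > 0\<close> for all
  admissible signals. It implies UGES with \<open>\<rho> = 1\<close>. Conversely, UGES with \<open>\<alpha> > 0\<close> contains it;
  if \<open>\<alpha> = 0\<close>, then \<open>\<rho> < 1\<close>, and on a sufficiently long window either there are so many
  switches that the powers of \<open>\<rho>\<close> contract, or by the pigeonhole principle one pause between
  switches is so long that the exponential decay of the active mode contracts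
  (\<open>UES_if_UGES\<close>). A contraction on windows of one fixed length can be iterated.

  From timer functionals to uniform stability: start the timer at its saturated value and reset
  it to \<open>0\<close> at each switch. The timer functional along a trajectory does not jump up at
  switches, because the dwell time has saturated the timer by then, and between switches the
  Dini inequality makes it decrease at rate at least \<open>norm x powr p\<close> (\<open>timer_decrease\<close>). Hence no
  trajectory can keep its norm above a fixed level for long (\<open>dissipation_bound\<close>). Since at
  most one switch occurs within a dwell time, the norm cannot collapse and recover within such
  a window either, and Datko's argument turns the two facts first into a uniform bound and then
  into a contraction (\<open>UES_if_timer_functionals\<close>).

  From uniform stability to the witness: the cost integral of a trajectory is bounded by a
  multiple of \<open>norm x powr p\<close> and locally Lipschitz in the initial state, uniformly over
  signals, and both properties pass to the supremum. Everything else follows from one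
  inequality. Running mode \<open>i\<close> for a time \<open>h\<close> before an admissible signal gives an admissible
  signal, whose cost splits into the part up to time \<open>h\<close> and the cost of the original signal
  started at \<open>S i h x\<close> (\<open>V_step\<close>). If the mode does not change at time \<open>h\<close>, this
  yields the Dini inequality and, together with the Lipschitz bound, continuity in the timer;
  if it changes, letting \<open>h\<close> tend to \<open>0\<close> yields the inequality across switches.
\<close>

section \<open>Switching signals and their evolution\<close>

text \<open>A signal is right continuous everywhere, and left continuous off its switching
  instants, so away from them it is locally constant; intervals are connected.\<close>

lemma signal_const:
  assumes sig: "switching_signal \<eta>" and "0 \<le> s" "s \<le> t"
    and none: "switching_instants \<eta> \<inter> {s<..t} = {}"
  shows "\<eta> t = \<eta> s"
proof (rule connected_local_const[of "{s..t}" s t \<eta>, symmetric])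
  show "connected {s..t}" by simp
  show "s \<in> {s..t}" "t \<in> {s..t}" using assms by auto
  show "\<forall>a\<in>{s..t}. \<forall>\<^sub>F b in at a within {s..t}. \<eta> a = \<eta> b"
  proof
    fix a assume a: "a \<in> {s..t}"
    then have "\<forall>\<^sub>F b in at_right a. \<eta> b = \<eta> a"
      using sig \<open>0 \<le> s\<close> by (simp add: switching_signal_def)
    then have R: "\<forall>\<^sub>F b in at_right a. \<eta> a = \<eta> b" by eventually_elim simp
    show "\<forall>\<^sub>F b in at a within {s..t}. \<eta> a = \<eta> b"
    proof (cases "a = s")
      case True
      have "at a within {s..t} = (if s < t then at_right a else bot)"
        unfolding True using \<open>s \<le> t\<close> by (auto simp: at_within_Icc_at_right at_within_eq_bot_iff)
      then show ?thesis using R by simp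
    next
      case False
      with a have "a \<notin> switching_instants \<eta>" "0 < a" using none \<open>0 \<le> s\<close> by auto
      then have "\<forall>\<^sub>F b in at_left a. \<eta> b = \<eta> a"
        by (simp add: switching_instants_def)
      then have "\<forall>\<^sub>F b in at_left a. \<eta> a = \<eta> b" by eventually_elim simp
      with R have "\<forall>\<^sub>F b in at a. \<eta> a = \<eta> b" by (simp add: eventually_at_split)
      then show ?thesis by (rule filter_leD[rotated]) (simp add: at_le)
    qed
  qed
qed

lemma finite_switching_instants:
  assumes "switching_signal \<eta>" and "0 \<le> s"
  shows "finite (switching_instants \<eta> \<inter> {s<..t})"
  by (rule finite_subset[of _ "switching_instants \<eta> \<inter> {0..t}"])
     (use assms in \<open>auto simp: switching_signal_def\<close>)

lemma first_switch_cases: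
  assumes sig: "switching_signal \<eta>" and "0 \<le> s"
  obtains "switching_instants \<eta> \<inter> {s<..t} = {}"
  | r where "s < r" "r \<le> t" "r \<in> switching_instants \<eta>" "switching_instants \<eta> \<inter> {s<..<r} = {}"
proof -
  let ?A = "switching_instants \<eta> \<inter> {s<..t}"
  have fin: "finite ?A" using finite_switching_instants[OF assms] .
  show ?thesis
  proof (cases "?A = {}")
    case False
    have "Min ?A \<in> ?A" using fin False by (rule Min_in)
    moreover have "\<forall>u\<in>?A. Min ?A \<le> u" using fin by simp
    ultimately show ?thesis by (intro that(2)[of "Min ?A"]) force+
  qed (rule that(1))
qed

text \<open>Downward induction on the left end point \<open>s\<close>: statements about the interval from \<open>s\<close> to \<open>t\<close>
  are reduced to the interval that starts at the first switch after \<open>s\<close>.\<close>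

lemma switch_induct [consumes 3, case_names const switch]:
  assumes sig: "switching_signal \<eta>" and "0 \<le> s" "s \<le> t"
    and const: "\<And>s. 0 \<le> s \<Longrightarrow> s \<le> t \<Longrightarrow> switching_instants \<eta> \<inter> {s<..t} = {} \<Longrightarrow> P s"
    and switch: "\<And>s r. 0 \<le> s \<Longrightarrow> s < r \<Longrightarrow> r \<le> t \<Longrightarrow> r \<in> switching_instants \<eta> \<Longrightarrow>
      switching_instants \<eta> \<inter> {s<..<r} = {} \<Longrightarrow> P r \<Longrightarrow> P s"
  shows "P s"
  using assms(2,3)
proof (induction "card (switching_instants \<eta> \<inter> {s<..t})" arbitrary: s rule: less_induct)
  case less
  show ?case
  proof (cases rule: first_switch_cases[OF sig less.prems(1), of t])
    case 1
    then show ?thesis using const less.prems by blast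
  next
    case (2 r)
    then have "switching_instants \<eta> \<inter> {r<..t} \<subset> switching_instants \<eta> \<inter> {s<..t}" by force
    then have "card (switching_instants \<eta> \<inter> {r<..t}) < card (switching_instants \<eta> \<inter> {s<..t})"
      by (rule psubset_card_mono[OF finite_switching_instants[OF sig less.prems(1)]])
    then have "P r" using less.hyps[of r] less.prems 2 by auto
    then show ?thesis using switch[of s r] less.prems 2 by auto
  qed
qed

lemma mode_before_switch:
  assumes sig: "switching_signal \<eta>" and "0 \<le> s" "s \<le> u" "u < r"
    and none: "switching_instants \<eta> \<inter> {s<..<r} = {}"
  shows "\<eta> u = \<eta> s"
proof -
  have "{s<..u} \<subseteq> {s<..<r}" using \<open>u < r\<close> by auto
  then have "switching_instants \<eta> \<inter> {s<..u} = {}" using none by blast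
  with sig \<open>0 \<le> s\<close> \<open>s \<le> u\<close> show ?thesis by (rule signal_const)
qed

lemma mode_changes_at_switch:
  assumes sig: "switching_signal \<eta>" and "0 \<le> s" "s < r" and r: "r \<in> switching_instants \<eta>"
    and none: "switching_instants \<eta> \<inter> {s<..<r} = {}"
  shows "\<eta> r \<noteq> \<eta> s"
proof
  assume eq: "\<eta> r = \<eta> s"
  have "\<forall>\<^sub>F u in at_left r. s < u \<and> u < r"
    using \<open>s < r\<close> by (intro eventually_at_leftI[of s]) auto
  then have "\<forall>\<^sub>F u in at_left r. \<eta> u = \<eta> r"
  proof eventually_elim
    case (elim u)
    then show ?case using mode_before_switch[OF sig \<open>0 \<le> s\<close> _ _ none, of u] eq by simp
  qed
  then show False using r by (simp add: switching_instants_def)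
qed

lemma evolution_no_switch:
  assumes "switching_instants \<eta> \<inter> {s<..t} = {}"
  shows "evolution S \<eta> t s = S (\<eta> s) (t - s)"
  by (simp add: evolution_def assms)

text \<open>The recursive description of the evolution on which every proof by \<open>switch_induct\<close>
  rests: the list of switching instants is unfolded once and then disappears from view.\<close>

lemma evolution_first_switch:
  assumes sig: "switching_signal \<eta>" and "0 \<le> s" "s < r" "r \<le> t" and r: "r \<in> switching_instants \<eta>"
    and none: "switching_instants \<eta> \<inter> {s<..<r} = {}"
  shows "evolution S \<eta> t s = evolution S \<eta> t r o\<^sub>L S (\<eta> s) (r - s)"
proof -
  let ?A = "switching_instants \<eta> \<inter> {s<..t}"
  have fin: "finite ?A" using finite_switching_instants[OF sig \<open>0 \<le> s\<close>] .
  have "r \<in> ?A" using assms by auto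
  moreover have "r \<le> u" if "u \<in> ?A" for u using none that by force
  ultimately have "Min ?A = r" using fin by (intro Min_eqI) auto
  moreover have "?A - {r} = switching_instants \<eta> \<inter> {r<..t}"
    using none assms by force
  moreover have "?A \<noteq> {}" using \<open>r \<in> ?A\<close> by auto
  ultimately have "sorted_list_of_set ?A = r # sorted_list_of_set (switching_instants \<eta> \<inter> {r<..t})"
    using sorted_list_of_set_nonempty[OF fin] by simp
  then show ?thesis by (simp add: evolution_def)
qed

text \<open>If there is a switch between \<open>s\<close> and \<open>r\<close>, it is split off on both sides. Otherwise \<open>r\<close> cuts
  the first mode interval after \<open>s\<close>, and the semigroup law of the active mode glues the two
  pieces.\<close>

lemma evolution_compose:
  assumes sg: "\<And>i. C0_semigroup (S i)" and sig: "switching_signal \<eta>"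
    and "0 \<le> s" "s \<le> r" "r \<le> t"
  shows "evolution S \<eta> t s = evolution S \<eta> t r o\<^sub>L evolution S \<eta> r s"
  using sig \<open>0 \<le> s\<close> \<open>s \<le> r\<close>
proof (induction s rule: switch_induct)
  case (const s)
  have r: "\<eta> r = \<eta> s" using sig const by (rule signal_const)
  have rs: "evolution S \<eta> r s = S (\<eta> s) (r - s)" using const(3) by (rule evolution_no_switch)
  have split: "S (\<eta> s) (u - s) = S (\<eta> r) (u - r) o\<^sub>L S (\<eta> s) (r - s)" if "r \<le> u" for u
  proof -
    have "S (\<eta> s) ((u - r) + (r - s)) = S (\<eta> s) (u - r) o\<^sub>L S (\<eta> s) (r - s)"
      using sg[of "\<eta> s"] that const unfolding C0_semigroup_def by (metis diff_ge_0_iff_ge)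
    then show ?thesis using r by simp
  qed
  have "0 \<le> r" using const by simp
  have "evolution S \<eta> t s = evolution S \<eta> t r o\<^sub>L S (\<eta> s) (r - s)"
  proof (cases rule: first_switch_cases[OF sig \<open>0 \<le> r\<close>, of t])
    case 1
    then have "switching_instants \<eta> \<inter> {s<..t} = {}" using const(3) by force
    then show ?thesis
      using split[OF \<open>r \<le> t\<close>] evolution_no_switch[OF 1, of S] by (simp only: evolution_no_switch)
  next
    case (2 u)
    have none: "switching_instants \<eta> \<inter> {s<..<u} = {}" using const(3) 2 by force
    have "evolution S \<eta> t s = evolution S \<eta> t u o\<^sub>L S (\<eta> s) (u - s)"
      using 2 const by (intro evolution_first_switch[OF sig _ _ _ _ none]) simp_all
    moreover have "evolution S \<eta> t r = evolution S \<eta> t u o\<^sub>L S (\<eta> r) (u - r)"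
      by (rule evolution_first_switch[OF sig \<open>0 \<le> r\<close> 2])
    moreover have "S (\<eta> s) (u - s) = S (\<eta> r) (u - r) o\<^sub>L S (\<eta> s) (r - s)"
      using 2 by (intro split) simp
    ultimately show ?thesis by (simp add: blinfun_eqI)
  qed
  then show ?case by (simp add: rs)
next
  case (switch s u)
  have first: "evolution S \<eta> v s = evolution S \<eta> v u o\<^sub>L S (\<eta> s) (u - s)" if "u \<le> v" for v
    by (rule evolution_first_switch[OF sig switch(1,2) that switch(4,5)])
  have "u \<le> t" using \<open>u \<le> r\<close> \<open>r \<le> t\<close> by simp
  then show ?case
    unfolding first[OF \<open>u \<le> t\<close>] first[OF \<open>u \<le> r\<close>] switch.IH by (simp add: blinfun_eqI)
qed

lemma evolution_refl:
  assumes "C0_semigroup (S (\<eta> s))"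
  shows "evolution S \<eta> s s = id_blinfun"
  using assms by (simp add: evolution_no_switch C0_semigroup_def)

section \<open>Exponentially stable modes\<close>

text \<open>Since there are finitely many modes, the decay constants can be chosen common to all of
  them.\<close>

locale stable_modes =
  fixes S :: "'n::finite \<Rightarrow> real \<Rightarrow> 'a::banach \<Rightarrow>\<^sub>L 'a" and T M \<omega> :: real
  assumes semigroup: "C0_semigroup (S i)"
    and T_pos: "0 < T" and M_ge_1: "1 \<le> M" and \<omega>_pos: "0 < \<omega>"
    and decay: "0 \<le> t \<Longrightarrow> norm (S i t) \<le> M * exp (- \<omega> * t)"
begin

lemma S_0 [simp]: "S i 0 = id_blinfun"
  using semigroup by (simp add: C0_semigroup_def)

lemma S_add: "0 \<le> s \<Longrightarrow> 0 \<le> t \<Longrightarrow> S i (s + t) = S i s o\<^sub>L S i t"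
  using semigroup by (simp add: C0_semigroup_def)

lemma norm_S_le: "0 \<le> t \<Longrightarrow> norm (S i t) \<le> M"
proof -
  assume "0 \<le> t"
  then have "M * exp (- \<omega> * t) \<le> M * 1"
    using M_ge_1 \<omega>_pos by (intro mult_left_mono) auto
  with decay[OF \<open>0 \<le> t\<close>, of i] show ?thesis by simp
qed

lemma norm_orbit_le: "0 \<le> t \<Longrightarrow> norm (S i t x) \<le> M * norm x"
  by (rule order_trans[OF norm_blinfun]) (simp add: mult_right_mono norm_S_le)

lemma orbit_tendsto: "((\<lambda>h. S i h x) \<longlongrightarrow> x) (at_right 0)"
  using semigroup by (simp add: C0_semigroup_def)

text \<open>Strong continuity at every time is controlled by strong continuity at \<open>0\<close> alone, because the
  semigroup is bounded.\<close>

lemma orbit_modulus: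
  assumes "0 \<le> s" "s \<le> t"
  shows "norm (S i t x - S i s x) \<le> M * norm (S i (t - s) x - x)"
proof -
  have "S i t x - S i s x = S i s (S i (t - s) x - x)"
    using S_add[of s "t - s" i] assms by (simp add: blinfun.diff_right)
  then show ?thesis using norm_orbit_le[OF \<open>0 \<le> s\<close>] by simp
qed

lemma orbit_uniformly_continuous:
  assumes "0 < \<epsilon>"
  obtains \<delta> where "0 < \<delta>" "\<And>h. 0 \<le> h \<Longrightarrow> h < \<delta> \<Longrightarrow> norm (S i h x - x) < \<epsilon>"
proof -
  have "\<forall>\<^sub>F h in at_right 0. dist (S i h x) x < \<epsilon>"
    using orbit_tendsto assms by (rule tendstoD)
  then obtain \<delta> where \<delta>: "0 < \<delta>" "\<And>h. 0 < h \<Longrightarrow> h < \<delta> \<Longrightarrow> dist (S i h x) x < \<epsilon>"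
    by (auto simp: eventually_at_right_field)
  show ?thesis
  proof (rule that[OF \<delta>(1)])
    fix h assume "0 \<le> h" "h < \<delta>"
    then show "norm (S i h x - x) < \<epsilon>"
      using \<delta>(2)[of h] assms by (cases "h = 0") (auto simp: dist_norm)
  qed
qed

lemma orbit_continuous: "continuous_on {0..} (\<lambda>t. S i t x)"
  unfolding continuous_on_iff
proof (intro ballI allI impI)
  fix t \<epsilon> :: real assume "t \<in> {0..}" "0 < \<epsilon>"
  then obtain \<delta> where \<delta>: "0 < \<delta>" "\<And>h. 0 \<le> h \<Longrightarrow> h < \<delta> \<Longrightarrow> norm (S i h x - x) < \<epsilon> / M"
    using orbit_uniformly_continuous[of "\<epsilon> / M" i x] M_ge_1 by auto
  have close: "norm (S i b x - S i a x) < \<epsilon>" if "0 \<le> a" "a \<le> b" "b - a < \<delta>" for a b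
    using orbit_modulus[OF that(1,2), of i x] \<delta>(2)[of "b - a"] that M_ge_1
    by (simp add: field_simps)
  show "\<exists>\<delta>>0. \<forall>u\<in>{0..}. dist u t < \<delta> \<longrightarrow> dist (S i u x) (S i t x) < \<epsilon>"
  proof (intro exI[of _ \<delta>] conjI ballI impI \<delta>(1))
    fix u assume "u \<in> {0..}" "dist u t < \<delta>"
    then show "dist (S i u x) (S i t x) < \<epsilon>"
      using close[of u t] close[of t u] \<open>t \<in> {0..}\<close>
      by (cases "u \<le> t") (auto simp: dist_norm norm_minus_commute abs_if split: if_splits)
  qed
qed

text \<open>At a switch \<open>r\<close> the evolution from \<open>r\<close> to \<open>r\<close> is the identity, so the formula of the old mode
  persists up to and including \<open>r\<close> and the pieces on two closed intervals fit together.\<close>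

lemma evolution_continuous_Icc:
  assumes sig: "switching_signal \<eta>" and "0 \<le> s" "s \<le> t"
  shows "continuous_on {s..t} (\<lambda>u. evolution S \<eta> u s x)"
  using assms
proof (induction s arbitrary: x rule: switch_induct)
  case (const s)
  have "continuous_on {s..t} (\<lambda>u. S (\<eta> s) (u - s) x)"
    by (rule continuous_on_compose2[OF orbit_continuous]) (auto intro!: continuous_intros)
  moreover have "evolution S \<eta> u s = S (\<eta> s) (u - s)" if "u \<in> {s..t}" for u
    using const(3) that by (intro evolution_no_switch) auto
  ultimately show ?case by (auto intro: continuous_on_eq)
next
  case (switch s r)
  have later: "evolution S \<eta> u s = evolution S \<eta> u r o\<^sub>L S (\<eta> s) (r - s)" if "u \<in> {r..t}" for u
    using that by (intro evolution_first_switch[OF sig switch(1,2) _ switch(4,5)]) auto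
  have "evolution S \<eta> u s = S (\<eta> s) (u - s)" if "u \<in> {s..r}" for u
  proof (cases "u = r")
    case True
    then show ?thesis
      using later[of r] switch(3) by (simp add: evolution_refl semigroup blinfun_eqI)
  next
    case False
    then have "switching_instants \<eta> \<inter> {s<..u} = {}"
      using switch(5) that by (force simp: disjoint_iff)
    then show ?thesis by (rule evolution_no_switch)
  qed
  moreover have "continuous_on {s..r} (\<lambda>u. S (\<eta> s) (u - s) x)"
    by (rule continuous_on_compose2[OF orbit_continuous]) (auto intro!: continuous_intros)
  ultimately have "continuous_on {s..r} (\<lambda>u. evolution S \<eta> u s x)"
    by (auto intro: continuous_on_eq)
  moreover have "continuous_on {r..t} (\<lambda>u. evolution S \<eta> u s x)"
    using switch.IH[of "S (\<eta> s) (r - s) x"] later by (auto intro: continuous_on_eq)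
  moreover have "{s..t} = {s..r} \<union> {r..t}" using switch(2,3) by auto
  ultimately show ?case by (simp add: continuous_on_closed_Un)
qed

lemma evolution_continuous:
  assumes sig: "switching_signal \<eta>"
  shows "continuous_on {0..} (\<lambda>t. evolution S \<eta> t 0 x)"
  unfolding continuous_on_eq_continuous_within
proof
  fix t :: real assume t: "t \<in> {0..}"
  have "continuous (at t within {0..t + 1}) (\<lambda>t. evolution S \<eta> t 0 x)"
    using evolution_continuous_Icc[OF sig order_refl, of "t + 1" x] t
    by (simp add: continuous_on_eq_continuous_within)
  moreover have "at t within {0..t + 1} = at t within {0..}"
    by (rule at_within_nhd[of t "{..<t + 1}"]) auto
  ultimately show "continuous (at t within {0..}) (\<lambda>t. evolution S \<eta> t 0 x)"
    by (simp add: continuous_within)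
qed

text \<open>A window no longer than the dwell time contains at most one switch, so at most two semigroup
  factors occur.\<close>

lemma norm_evolution_short:
  assumes \<eta>: "\<eta> \<in> Sigma_min T" and "0 \<le> s" "s \<le> t" "t - s \<le> T"
  shows "norm (evolution S \<eta> t s) \<le> M\<^sup>2"
proof -
  have sig: "switching_signal \<eta>" and dwell: "dwell_at_least T \<eta>"
    using \<eta> by (auto simp: Sigma_min_def)
  show ?thesis
  proof (cases rule: first_switch_cases[OF sig \<open>0 \<le> s\<close>, of t])
    case 1
    have "M * 1 \<le> M * M" using M_ge_1 by (intro mult_left_mono) auto
    then show ?thesis using evolution_no_switch[OF 1, of S] norm_S_le[of "t - s" "\<eta> s"] \<open>s \<le> t\<close>
      by (simp add: power2_eq_square)
  next
    case (2 r)
    have "switching_instants \<eta> \<inter> {r<..t} = {}"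
      using dwell 2 \<open>t - s \<le> T\<close> by (force simp: dwell_at_least_def)
    then have "evolution S \<eta> t s = S (\<eta> r) (t - r) o\<^sub>L S (\<eta> s) (r - s)"
      using evolution_first_switch[OF sig \<open>0 \<le> s\<close> 2, of S] evolution_no_switch[of \<eta> r t S] by simp
    also have "norm \<dots> \<le> norm (S (\<eta> r) (t - r)) * norm (S (\<eta> s) (r - s))"
      by (rule norm_blinfun_compose)
    also have "\<dots> \<le> M * M" using 2 M_ge_1 by (intro mult_mono norm_S_le) auto
    finally show ?thesis by (simp add: power2_eq_square)
  qed
qed

lemma evolution_comp:
  assumes "\<eta> \<in> Sigma_min T" "0 \<le> s" "s \<le> r" "r \<le> t"
  shows "evolution S \<eta> t s = evolution S \<eta> t r o\<^sub>L evolution S \<eta> r s"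
  using assms by (intro evolution_compose semigroup) (auto simp: Sigma_min_def)

lemma norm_evolution_comp_le:
  assumes "\<eta> \<in> Sigma_min T" "0 \<le> s" "s \<le> r" "r \<le> t"
  shows "norm (evolution S \<eta> t s) \<le> norm (evolution S \<eta> t r) * norm (evolution S \<eta> r s)"
  using evolution_comp[OF assms] norm_blinfun_compose by metis

section \<open>Uniform exponential stability\<close>

definition UES :: bool where
  "UES \<longleftrightarrow> (\<exists>K\<ge>1. \<exists>\<beta>>0. \<forall>\<eta>\<in>Sigma_min T. \<forall>s t. 0 \<le> s \<and> s \<le> t \<longrightarrow>
     norm (evolution S \<eta> t s) \<le> K * exp (- \<beta> * (t - s)))"

lemma UES_if_contraction:
  assumes "0 < \<theta>"
    and bounded: "\<And>\<eta> s t. \<eta> \<in> Sigma_min T \<Longrightarrow> 0 \<le> s \<Longrightarrow> s \<le> t \<Longrightarrow> norm (evolution S \<eta> t s) \<le> C"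
    and contract: "\<And>\<eta> s. \<eta> \<in> Sigma_min T \<Longrightarrow> 0 \<le> s \<Longrightarrow> norm (evolution S \<eta> (s + \<theta>) s) \<le> 1 / 2"
  shows UES
  unfolding UES_def
proof (intro exI conjI ballI allI impI)
  show "1 \<le> 2 * max C 1" "0 < ln 2 / \<theta>" using \<open>0 < \<theta>\<close> by auto
  fix \<eta> :: "real \<Rightarrow> 'n" and s t :: real assume \<eta>: "\<eta> \<in> Sigma_min T" and st: "0 \<le> s \<and> s \<le> t"
  have iterate: "norm (evolution S \<eta> (s + real n * \<theta>) s) \<le> (1 / 2) ^ n" for n
  proof (induction n)
    case 0
    then show ?case using semigroup by (simp add: evolution_refl norm_blinfun_id_le)
  next
    case (Suc n)
    have "norm (evolution S \<eta> (s + real n * \<theta> + \<theta>) s) \<le>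
        norm (evolution S \<eta> (s + real n * \<theta> + \<theta>) (s + real n * \<theta>)) * norm (evolution S \<eta> (s + real n * \<theta>) s)"
      using st \<open>0 < \<theta>\<close> by (intro norm_evolution_comp_le[OF \<eta>]) auto
    also have "\<dots> \<le> 1 / 2 * (1 / 2) ^ n"
      using st \<open>0 < \<theta>\<close> Suc by (intro mult_mono contract[OF \<eta>]) auto
    finally show ?case by (simp add: algebra_simps)
  qed
  define n where "n = nat \<lfloor>(t - s) / \<theta>\<rfloor>"
  have "0 \<le> (t - s) / \<theta>" using st \<open>0 < \<theta>\<close> by simp
  then have n: "real n \<le> (t - s) / \<theta>" "(t - s) / \<theta> < real n + 1" unfolding n_def by linarith+
  have le: "s + real n * \<theta> \<le> t" using n(1) \<open>0 < \<theta>\<close> by (simp add: field_simps)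
  have "norm (evolution S \<eta> t s) \<le> norm (evolution S \<eta> t (s + real n * \<theta>)) * norm (evolution S \<eta> (s + real n * \<theta>) s)"
    using st \<open>0 < \<theta>\<close> le by (intro norm_evolution_comp_le[OF \<eta>]) auto
  also have "\<dots> \<le> max C 1 * (1 / 2) ^ n"
    using st \<open>0 < \<theta>\<close> le iterate[of n] bounded[OF \<eta> _ le] by (intro mult_mono) (auto simp: le_max_iff_disj)
  also have "\<dots> \<le> max C 1 * (2 * exp (- (ln 2 / \<theta>) * (t - s)))"
  proof (rule mult_left_mono)
    have "ln 2 * ((t - s) / \<theta>) \<le> ln 2 * (real n + 1)" using n(2) by (intro mult_left_mono) auto
    then have "- (ln 2 * real n) \<le> ln 2 + - (ln 2 / \<theta>) * (t - s)" by (simp add: algebra_simps)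
    then have "exp (- (ln 2 * real n)) \<le> exp (ln 2 + - (ln 2 / \<theta>) * (t - s))"
      by (rule exp_le_cancel_iff[THEN iffD2])
    then have "exp (- (ln 2 * real n)) \<le> 2 * exp (- (ln 2 / \<theta>) * (t - s))"
      unfolding exp_add by simp
    moreover have "(1 / 2 :: real) ^ n = exp (- (ln 2 * real n))"
      by (simp add: exp_minus exp_of_nat2_mult power_one_over inverse_eq_divide)
    ultimately show "(1 / 2) ^ n \<le> 2 * exp (- (ln 2 / \<theta>) * (t - s))" by simp
  qed simp
  finally show "norm (evolution S \<eta> t s) \<le> 2 * max C 1 * exp (- (ln 2 / \<theta>) * (t - s))"
    by (simp add: ac_simps)
qed

text \<open>Pigeonhole principle: divide the window into \<open>n\<close> consecutive cells of length \<open>L\<close>; if no cell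
  is free of switches, there are at least \<open>n\<close> switches.\<close>

lemma long_pause_or_many_switches:
  assumes sig: "switching_signal \<eta>" and "0 \<le> s" "0 < L"
  shows "(\<exists>a\<ge>s. a + L \<le> s + real n * L \<and> switching_instants \<eta> \<inter> {a<..a + L} = {}) \<or>
    n \<le> switch_count \<eta> (s + real n * L) s"
proof (induction n)
  case 0
  then show ?case by simp
next
  case (Suc n)
  let ?e = "s + real n * L"
  have e: "s + real (Suc n) * L = ?e + L" by (simp add: algebra_simps)
  have "s \<le> ?e" using \<open>0 < L\<close> by simp
  show ?case
  proof (cases "switching_instants \<eta> \<inter> {?e<..?e + L} = {}")
    case True
    then show ?thesis unfolding e using \<open>s \<le> ?e\<close> by blast
  next
    case False
    then obtain r where r: "r \<in> switching_instants \<eta>" "?e < r" "r \<le> ?e + L" by auto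
    from Suc show ?thesis
    proof
      assume "\<exists>a\<ge>s. a + L \<le> ?e \<and> switching_instants \<eta> \<inter> {a<..a + L} = {}"
      then show ?thesis unfolding e using \<open>0 < L\<close> by force
    next
      assume n: "n \<le> switch_count \<eta> ?e s"
      let ?A = "switching_instants \<eta> \<inter> {s<..?e}"
      have "Suc n \<le> card (insert r ?A)"
        using n r finite_switching_instants[OF sig \<open>0 \<le> s\<close>] by (simp add: switch_count_def)
      also have "\<dots> \<le> switch_count \<eta> (?e + L) s"
        unfolding switch_count_def
      proof (intro card_mono finite_switching_instants[OF sig \<open>0 \<le> s\<close>])
        show "insert r ?A \<subseteq> switching_instants \<eta> \<inter> {s<..?e + L}"
          using r order_le_less_trans[OF \<open>s \<le> ?e\<close> r(2)] \<open>0 < L\<close> by auto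
      qed
      finally show ?thesis unfolding e by blast
    qed
  qed
qed

text \<open>If \<open>\<alpha> = 0\<close>, only switches contract, and a signal may rest for arbitrarily long in one mode;
  there the exponential stability of the mode takes over.\<close>

lemma UES_if_UGES:
  assumes "UGES S (Sigma_min T)"
  shows UES
proof -
  obtain K \<alpha> \<rho> where K: "1 \<le> K" and \<alpha>: "0 \<le> \<alpha>" and \<rho>: "0 < \<rho>" "\<rho> \<le> 1" and rate: "0 < \<alpha> - ln \<rho>"
    and bound: "\<And>\<eta> s t. \<eta> \<in> Sigma_min T \<Longrightarrow> 0 \<le> s \<Longrightarrow> s \<le> t \<Longrightarrow>
      norm (evolution S \<eta> t s) \<le> K * \<rho> ^ switch_count \<eta> t s * exp (- \<alpha> * (t - s))"
    using assms unfolding UGES_def by blast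
  show ?thesis
  proof (cases "\<alpha> = 0")
    case False
    show ?thesis
      unfolding UES_def
    proof (intro exI conjI ballI allI impI)
      show "1 \<le> K" "0 < \<alpha>" using K \<alpha> False by auto
      fix \<eta> :: "real \<Rightarrow> 'n" and s t :: real assume \<eta>: "\<eta> \<in> Sigma_min T" and st: "0 \<le> s \<and> s \<le> t"
      have "norm (evolution S \<eta> t s) \<le> K * \<rho> ^ switch_count \<eta> t s * exp (- \<alpha> * (t - s))"
        using bound[OF \<eta>] st by blast
      also have "\<dots> \<le> K * 1 * exp (- \<alpha> * (t - s))"
        using K \<rho> by (intro mult_right_mono mult_left_mono power_le_one) auto
      finally show "norm (evolution S \<eta> t s) \<le> K * exp (- \<alpha> * (t - s))" by simp
    qed
  next
    case True
    then have "\<rho> < 1" using rate \<rho> by simp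
    then obtain n where n: "\<rho> ^ n < 1 / (2 * K)" using real_arch_pow_inv[of "1 / (2 * K)" \<rho>] K by auto
    \<comment> \<open>The factors before and after a pause of length \<open>L\<close> cost at most \<open>K\<close> each; this \<open>L\<close> makes
      \<open>K * (M * exp (- \<omega> * L)) * K = 1 / 2\<close>.\<close>
    define L where "L = ln (2 * K\<^sup>2 * M) / \<omega>"
    have ge2: "2 \<le> 2 * K\<^sup>2 * M"
      using mult_mono[of 1 "K\<^sup>2" 1 M] K M_ge_1 by simp
    then have "0 < ln (2 * K\<^sup>2 * M)" by (intro ln_gt_zero) linarith
    then have "0 < L" unfolding L_def using \<omega>_pos by (rule divide_pos_pos)
    have "0 < 2 * K\<^sup>2 * M" using ge2 by linarith
    then have "exp (- \<omega> * L) = 1 / (2 * K\<^sup>2 * M)"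
      unfolding L_def using \<omega>_pos by (simp add: exp_minus inverse_eq_divide)
    have le_K: "norm (evolution S \<eta> t s) \<le> K * \<rho> ^ switch_count \<eta> t s" "norm (evolution S \<eta> t s) \<le> K"
      if "\<eta> \<in> Sigma_min T" "0 \<le> s" "s \<le> t" for \<eta> s t
    proof -
      show "norm (evolution S \<eta> t s) \<le> K * \<rho> ^ switch_count \<eta> t s"
        using bound[OF that] True by simp
      also have "\<dots> \<le> K * 1" using K \<rho> by (intro mult_left_mono power_le_one) auto
      finally show "norm (evolution S \<eta> t s) \<le> K" by simp
    qed
    have "n \<noteq> 0" using n K by (auto simp: field_simps intro: ccontr)
    show ?thesis
    proof (rule UES_if_contraction[of "real n * L" K])
      show "0 < real n * L" using \<open>n \<noteq> 0\<close> \<open>0 < L\<close> by simp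
      fix \<eta> :: "real \<Rightarrow> 'n" and s :: real assume \<eta>: "\<eta> \<in> Sigma_min T" and "0 \<le> s"
      let ?t = "s + real n * L"
      from \<eta> have sig: "switching_signal \<eta>" by (simp add: Sigma_min_def)
      from long_pause_or_many_switches[OF sig \<open>0 \<le> s\<close> \<open>0 < L\<close>, of n]
      show "norm (evolution S \<eta> ?t s) \<le> 1 / 2"
      proof (elim disjE exE conjE)
        fix a assume a: "s \<le> a" "a + L \<le> ?t" "switching_instants \<eta> \<inter> {a<..a + L} = {}"
        have "norm (evolution S \<eta> ?t s) \<le> norm (evolution S \<eta> ?t (a + L)) * norm (evolution S \<eta> (a + L) s)"
          using \<open>0 \<le> s\<close> \<open>0 < L\<close> a by (intro norm_evolution_comp_le[OF \<eta>]) auto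
        also have "\<dots> \<le> K * (norm (evolution S \<eta> (a + L) a) * norm (evolution S \<eta> a s))"
          using \<open>0 \<le> s\<close> \<open>0 < L\<close> a K
          by (intro mult_mono le_K[OF \<eta>] norm_evolution_comp_le[OF \<eta>]) auto
        also have "\<dots> \<le> K * ((M * exp (- \<omega> * L)) * K)"
        proof -
          have "norm (evolution S \<eta> (a + L) a) \<le> M * exp (- \<omega> * L)"
            using decay[of L "\<eta> a"] \<open>0 < L\<close> by (simp add: evolution_no_switch[OF a(3)])
          then show ?thesis
            using \<open>0 \<le> s\<close> a K M_ge_1 by (intro mult_left_mono mult_mono le_K(2)[OF \<eta>]) auto
        qed
        also have "\<dots> = 1 / 2"
          unfolding \<open>exp (- \<omega> * L) = _\<close> using K M_ge_1 by (simp add: power2_eq_square)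
        finally show ?thesis .
      next
        assume many: "n \<le> switch_count \<eta> ?t s"
        have "norm (evolution S \<eta> ?t s) \<le> K * \<rho> ^ switch_count \<eta> ?t s"
          using \<open>0 \<le> s\<close> \<open>0 < L\<close> by (intro le_K[OF \<eta>]) auto
        also have "\<dots> \<le> K * \<rho> ^ n"
          using many \<rho> K by (intro mult_left_mono power_decreasing) auto
        also have "\<dots> \<le> 1 / 2" using n K by (simp add: field_simps)
        finally show ?thesis .
      qed
    qed (use le_K in auto)
  qed
qed

lemma UGES_if_UES:
  assumes UES
  shows "UGES S (Sigma_min T)"
proof -
  obtain K \<beta> where K: "1 \<le> K" and \<beta>: "0 < \<beta>"
    and bound: "\<forall>\<eta>\<in>Sigma_min T. \<forall>s t. 0 \<le> s \<and> s \<le> t \<longrightarrow>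
      norm (evolution S \<eta> t s) \<le> K * exp (- \<beta> * (t - s))"
    using assms unfolding UES_def by blast
  show ?thesis
    unfolding UGES_def
  proof (rule exI[of _ K], rule exI[of _ \<beta>], rule exI[of _ 1], intro conjI)
    show "\<forall>\<eta>\<in>Sigma_min T. \<forall>s t. 0 \<le> s \<and> s \<le> t \<longrightarrow>
        norm (evolution S \<eta> t s) \<le> K * 1 ^ switch_count \<eta> t s * exp (- \<beta> * (t - s))"
      using bound by simp
  qed (use K \<beta> in auto)
qed

end

section \<open>Timer functionals force uniform exponential stability\<close>

text \<open>Let \<open>u\<close> be the difference between \<open>w\<close> and a line of the slightly weaker slope \<open>- m + \<epsilon>\<close>.
  If the claim failed, \<open>u\<close> would for small \<open>\<epsilon>\<close> end above its initial value; at the last time at which it is not above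
  that value, all right difference quotients are nonnegative for \<open>u\<close>, hence at least \<open>- m + \<epsilon>\<close>
  for \<open>w\<close>. This bound holds for all small \<open>h\<close>, so it contradicts the assumption even on the lower
  limit.\<close>

lemma dini_decrease:
  fixes w :: "real \<Rightarrow> real"
  assumes "a \<le> b" and cont: "continuous_on {a..b} w"
    and dini: "\<And>t. a \<le> t \<Longrightarrow> t < b \<Longrightarrow>
      Liminf (at_right 0) (\<lambda>h. ereal ((w (t + h) - w t) / h)) \<le> ereal (- m)"
  shows "w b + m * (b - a) \<le> w a"
proof (rule ccontr)
  assume "\<not> w b + m * (b - a) \<le> w a"
  then have less: "w a < w b + m * (b - a)" by simp
  with \<open>a \<le> b\<close> have "a < b" by (cases "a = b") auto
  define \<epsilon> where "\<epsilon> = (w b + m * (b - a) - w a) / (b - a) / 2"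
  have "0 < \<epsilon>" unfolding \<epsilon>_def using less \<open>a < b\<close> by simp
  define u where "u t = w t + (m - \<epsilon>) * (t - a)" for t
  have cancel: "x / d / 2 * d = x / 2" if "d \<noteq> 0" for x d :: real using that by simp
  have "\<epsilon> * (b - a) = (w b + m * (b - a) - w a) / 2"
    unfolding \<epsilon>_def by (rule cancel) (use \<open>a < b\<close> in simp)
  then have "u a < u b" unfolding u_def using less by (simp add: left_diff_distrib)
  have "continuous_on {a..b} u" unfolding u_def by (intro continuous_intros cont)
  then have "closed {t \<in> {a..b}. u t \<le> u a}"
    by (intro continuous_on_closed_Collect_le continuous_intros) auto
  moreover have "{t \<in> {a..b}. u t \<le> u a} = {a..b} \<inter> {t \<in> {a..b}. u t \<le> u a}" by auto
  ultimately have "compact {t \<in> {a..b}. u t \<le> u a}" by (metis compact_Icc compact_Int_closed)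
  moreover have "{t \<in> {a..b}. u t \<le> u a} \<noteq> {}" using \<open>a \<le> b\<close> by auto
  ultimately obtain t where t_in: "t \<in> {t \<in> {a..b}. u t \<le> u a}"
    and t_max: "\<forall>t'\<in>{t \<in> {a..b}. u t \<le> u a}. t' \<le> t"
    by (rule compact_attains_sup[THEN bexE])
  from t_in have t: "a \<le> t" "t \<le> b" "u t \<le> u a" by auto
  have last: "t' \<le> t" if "a \<le> t'" "t' \<le> b" "u t' \<le> u a" for t'
    using t_max that by simp
  have "t < b" using t \<open>u a < u b\<close> by (cases "t = b") auto
  have "\<forall>\<^sub>F h in at_right 0. h \<in> {0<..<b - t}"
    using \<open>t < b\<close> by (intro eventually_at_rightI[of _ "b - t"]) auto
  then have "\<forall>\<^sub>F h in at_right 0. ereal (- m + \<epsilon>) \<le> ereal ((w (t + h) - w t) / h)"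
  proof eventually_elim
    case (elim h)
    then have "\<not> u (t + h) \<le> u a" using last[of "t + h"] t by auto
    then have "u t < u (t + h)" using t by linarith
    then have "(- m + \<epsilon>) * h \<le> w (t + h) - w t" unfolding u_def by (simp add: algebra_simps)
    then show ?case using elim by (simp add: pos_le_divide_eq)
  qed
  then have "ereal (- m + \<epsilon>) \<le> Liminf (at_right 0) (\<lambda>h. ereal ((w (t + h) - w t) / h))"
    by (rule Liminf_bounded)
  with dini[OF t(1) \<open>t < b\<close>] have "ereal (- m + \<epsilon>) \<le> ereal (- m)" by (rule order_trans[rotated])
  then show False using \<open>0 < \<epsilon>\<close> by simp
qed

lemma powr_root_bound:
  fixes a b c T p :: real
  assumes "0 \<le> a" "0 \<le> b" "0 < c" "0 < T" "1 \<le> p" and le: "a powr p * T \<le> c * b powr p"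
  shows "a \<le> (c / T) powr (1 / p) * b"
proof (rule ccontr)
  assume "\<not> a \<le> (c / T) powr (1 / p) * b"
  then have "((c / T) powr (1 / p) * b) powr p < a powr p"
    using assms by (intro powr_less_mono2) auto
  moreover have "((c / T) powr (1 / p) * b) powr p = c / T * b powr p"
    using assms by (simp add: powr_mult powr_powr)
  moreover have "a powr p \<le> c / T * b powr p" using le \<open>0 < T\<close> by (simp add: field_simps)
  ultimately show False by linarith
qed

lemma timer_functionalsD:
  assumes "timer_functionals S T p c V"
  shows timer_nonneg: "\<tau> \<in> {0..T} \<Longrightarrow> 0 \<le> V i \<tau> x"
    and timer_lipschitz: "0 < r \<Longrightarrow> \<exists>L>0. \<forall>\<tau>\<in>{0..T}. \<forall>x y. norm x < r \<and> norm y < r \<longrightarrow>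
      \<bar>V i \<tau> x - V i \<tau> y\<bar> \<le> L * norm (x - y)"
    and timer_continuous: "continuous_on {0..T} (\<lambda>\<tau>. V i \<tau> x)"
    and timer_upper: "\<tau> \<in> {0..T} \<Longrightarrow> V i \<tau> x \<le> c * norm x powr p"
    and timer_dini: "\<tau> \<in> {0..T} \<Longrightarrow>
      lower_dini (S i) (timer_extend T (V i)) \<tau> x \<le> ereal (- (norm x powr p))"
    and timer_jump: "j \<noteq> i \<Longrightarrow> V j 0 x \<le> V i T x"
  using assms unfolding timer_functionals_def by (elim conjE, simp)+

context stable_modes
begin

text \<open>The Lipschitz constant is uniform in the timer, so separate continuity in the timer and in
  the state gives continuity along the curve in which both move.\<close>

lemma timer_functional_along_orbit_continuous:
  assumes tf: "timer_functionals S T p c V" and "0 \<le> \<tau>"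
  shows "continuous_on {0..l} (\<lambda>t. timer_extend T (V i) (\<tau> + t) (S i t y))"
  unfolding continuous_on_def
proof
  fix t assume t: "t \<in> {0..l}"
  let ?x = "\<lambda>u. S i u y" and ?\<tau> = "\<lambda>u. min (\<tau> + u) T"
  have \<tau>: "?\<tau> u \<in> {0..T}" if "0 \<le> u" for u using that \<open>0 \<le> \<tau>\<close> T_pos by auto
  obtain L where "0 < L" and L: "\<And>\<sigma> x x'. \<sigma> \<in> {0..T} \<Longrightarrow> norm x < M * norm y + 1 \<Longrightarrow>
      norm x' < M * norm y + 1 \<Longrightarrow> \<bar>V i \<sigma> x - V i \<sigma> x'\<bar> \<le> L * norm (x - x')"
  proof -
    have "0 < M * norm y + 1" using M_ge_1 by (simp add: add_nonneg_pos)
    from timer_lipschitz[OF tf this, of i] show ?thesis using that by blast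
  qed
  have "\<forall>\<^sub>F u in at t within {0..l}. u \<in> {0..l}" by (simp add: eventually_at_filter)
  then have "\<forall>\<^sub>F u in at t within {0..l}.
      norm (V i (?\<tau> u) (?x u) - V i (?\<tau> t) (?x t)) \<le>
        L * norm (?x u - ?x t) + \<bar>V i (?\<tau> u) (?x t) - V i (?\<tau> t) (?x t)\<bar>"
  proof eventually_elim
    case (elim u)
    then have "\<bar>V i (?\<tau> u) (?x u) - V i (?\<tau> u) (?x t)\<bar> \<le> L * norm (?x u - ?x t)"
      using t norm_orbit_le[of u i y] norm_orbit_le[of t i y] by (intro L \<tau>) auto
    then show ?case unfolding real_norm_def by linarith
  qed
  moreover have "((\<lambda>u. L * norm (?x u - ?x t) + \<bar>V i (?\<tau> u) (?x t) - V i (?\<tau> t) (?x t)\<bar>) \<longlongrightarrow> 0)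
      (at t within {0..l})"
  proof (intro tendsto_add_zero tendsto_mult_right_zero tendsto_norm_zero tendsto_rabs_zero)
    have "continuous_on {0..l} ?x" by (rule continuous_on_subset[OF orbit_continuous]) auto
    then show "((\<lambda>u. ?x u - ?x t) \<longlongrightarrow> 0) (at t within {0..l})"
      using t by (intro LIM_zero) (auto simp: continuous_on_def)
    have "continuous_on {0..T} (\<lambda>\<sigma>. V i \<sigma> (?x t))" by (rule timer_continuous[OF tf])
    then have "continuous_on {0..l} (\<lambda>u. V i (?\<tau> u) (?x t))"
      by (rule continuous_on_compose2[of "{0..T}" _ "{0..l}" ?\<tau>])
        (auto intro!: continuous_intros simp: \<tau>[simplified])
    then show "((\<lambda>u. V i (?\<tau> u) (?x t) - V i (?\<tau> t) (?x t)) \<longlongrightarrow> 0) (at t within {0..l})"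
      using t by (intro LIM_zero) (auto simp: continuous_on_def)
  qed
  ultimately have "((\<lambda>u. V i (?\<tau> u) (?x u) - V i (?\<tau> t) (?x t)) \<longlongrightarrow> 0) (at t within {0..l})"
    by (rule Lim_null_comparison)
  then show "((\<lambda>u. timer_extend T (V i) (\<tau> + u) (?x u)) \<longlongrightarrow> timer_extend T (V i) (\<tau> + t) (?x t))
      (at t within {0..l})"
    unfolding timer_extend_def by (rule LIM_zero_cancel)
qed

text \<open>The semigroup law turns the Dini derivative of the composite function of time into the Dini
  derivative of the functional at the current point of the orbit.\<close>

lemma mode_decrease:
  assumes tf: "timer_functionals S T p c V" and "0 \<le> \<tau>" "0 \<le> l"
    and m: "\<And>t. 0 \<le> t \<Longrightarrow> t \<le> l \<Longrightarrow> m \<le> norm (S i t y) powr p"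
  shows "timer_extend T (V i) (\<tau> + l) (S i l y) + m * l \<le> timer_extend T (V i) \<tau> y"
proof -
  define w where "w t = timer_extend T (V i) (\<tau> + t) (S i t y)" for t
  have "w l + m * (l - 0) \<le> w 0"
  proof (rule dini_decrease[OF \<open>0 \<le> l\<close>])
    show "continuous_on {0..l} w"
      unfolding w_def by (rule timer_functional_along_orbit_continuous[OF tf \<open>0 \<le> \<tau>\<close>])
    fix t assume t: "0 \<le> t" "t < l"
    let ?\<sigma> = "min (\<tau> + t) T"
    have "\<forall>\<^sub>F h in at_right 0. (0::real) < h" by (rule eventually_at_right_less)
    then have "\<forall>\<^sub>F h in at_right 0. ereal ((w (t + h) - w t) / h) =
        ereal ((timer_extend T (V i) (?\<sigma> + h) (S i h (S i t y)) - timer_extend T (V i) ?\<sigma> (S i t y)) / h)"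
    proof eventually_elim
      case (elim h)
      have "min (?\<sigma> + h) T = min (\<tau> + (t + h)) T" "min ?\<sigma> T = ?\<sigma>" using elim by auto
      moreover have "S i (t + h) y = S i h (S i t y)"
        using S_add[of h t i] t elim by (simp add: add.commute)
      ultimately show ?case by (simp add: w_def timer_extend_def)
    qed
    then have "Liminf (at_right 0) (\<lambda>h. ereal ((w (t + h) - w t) / h)) =
        lower_dini (S i) (timer_extend T (V i)) ?\<sigma> (S i t y)"
      unfolding lower_dini_def by (rule Liminf_eq)
    also have "\<dots> \<le> ereal (- (norm (S i t y) powr p))"
    proof -
      have "?\<sigma> \<in> {0..T}" using t \<open>0 \<le> \<tau>\<close> T_pos by auto
      then show ?thesis by (rule timer_dini[OF tf])
    qed
    also have "\<dots> \<le> ereal (- m)" using m[of t] t by simp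
    finally show "Liminf (at_right 0) (\<lambda>h. ereal ((w (t + h) - w t) / h)) \<le> ereal (- m)" .
  qed
  then show ?thesis by (simp add: w_def)
qed

text \<open>The hypothesis on \<open>\<tau>\<close> says that the timer will be saturated when the next switch occurs, which
  is exactly what the jump inequality of timer functionals requires. It is reproduced at the
  end time: within a mode the timer advances with time, and at a switch it is reset to \<open>0\<close>,
  where the dwell time restores it. So it is the invariant of the induction over the switches.\<close>

lemma timer_decrease:
  assumes tf: "timer_functionals S T p c V" and \<eta>: "\<eta> \<in> Sigma_min T" and "0 \<le> a" "a \<le> b" "0 \<le> \<tau>"
    and "\<forall>r\<in>switching_instants \<eta>. a < r \<longrightarrow> T \<le> \<tau> + (r - a)"
    and "\<And>t. a \<le> t \<Longrightarrow> t \<le> b \<Longrightarrow> m \<le> norm (evolution S \<eta> t a y) powr p"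
  obtains \<tau>' where "0 \<le> \<tau>'" "\<forall>r\<in>switching_instants \<eta>. b < r \<longrightarrow> T \<le> \<tau>' + (r - b)"
    "timer_extend T (V (\<eta> b)) \<tau>' (evolution S \<eta> b a y) + m * (b - a) \<le> timer_extend T (V (\<eta> a)) \<tau> y"
proof -
  have sig: "switching_signal \<eta>" and dwell: "dwell_at_least T \<eta>"
    using \<eta> by (auto simp: Sigma_min_def)
  have "\<exists>\<tau>'\<ge>0. (\<forall>r\<in>switching_instants \<eta>. b < r \<longrightarrow> T \<le> \<tau>' + (r - b)) \<and>
    timer_extend T (V (\<eta> b)) \<tau>' (evolution S \<eta> b a y) + m * (b - a) \<le> timer_extend T (V (\<eta> a)) \<tau> y"
    using sig assms(3-)
  proof (induction a arbitrary: \<tau> y rule: switch_induct)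
    case (const a)
    have evo: "evolution S \<eta> t a = S (\<eta> a) (t - a)" if "t \<le> b" for t
      using const(3) that by (intro evolution_no_switch) auto
    have "\<eta> b = \<eta> a" using sig const(1-3) by (rule signal_const)
    moreover have "timer_extend T (V (\<eta> a)) (\<tau> + (b - a)) (S (\<eta> a) (b - a) y) + m * (b - a) \<le>
        timer_extend T (V (\<eta> a)) \<tau> y"
    proof (rule mode_decrease[OF tf])
      fix t assume "0 \<le> t" "t \<le> b - a"
      then show "m \<le> norm (S (\<eta> a) t y) powr p" using const(6)[of "a + t"] evo[of "a + t"] by simp
    qed (use const in auto)
    moreover have "T \<le> \<tau> + (b - a) + (r - b)" if "r \<in> switching_instants \<eta>" "b < r" for r
      using const(2,5) that by (auto dest!: bspec[of _ _ r])
    ultimately show ?case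
      using const(2,4) evo[of b] by (intro exI[of _ "\<tau> + (b - a)"]) auto
  next
    case (switch a r)
    let ?z = "S (\<eta> a) (r - a) y"
    have later: "evolution S \<eta> t a = evolution S \<eta> t r o\<^sub>L S (\<eta> a) (r - a)" if "r \<le> t" for t
      by (rule evolution_first_switch[OF sig switch(1,2) that switch(4,5)])
    have before: "evolution S \<eta> t a = S (\<eta> a) (t - a)" if "a \<le> t" "t \<le> r" for t
    proof (cases "t = r")
      case True
      then show ?thesis using later[of r] by (simp add: evolution_refl semigroup blinfun_eqI)
    next
      case False
      then have "{a<..t} \<subseteq> {a<..<r}" using that by auto
      then show ?thesis using switch(5) by (intro evolution_no_switch) blast
    qed
    have "timer_extend T (V (\<eta> a)) (\<tau> + (r - a)) ?z + m * (r - a) \<le> timer_extend T (V (\<eta> a)) \<tau> y"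
    proof (rule mode_decrease[OF tf])
      fix t assume "0 \<le> t" "t \<le> r - a"
      then show "m \<le> norm (S (\<eta> a) t y) powr p"
        using switch.prems(3)[of "a + t"] before[of "a + t"] switch(3) by simp
    qed (use switch in auto)
    moreover have "V (\<eta> r) 0 ?z \<le> V (\<eta> a) T ?z"
      by (rule timer_jump[OF tf mode_changes_at_switch[OF sig switch(1,2,4,5)]])
    moreover have "T \<le> \<tau> + (r - a)" using switch.prems(2) switch(2,4) by blast
    ultimately have jump: "timer_extend T (V (\<eta> r)) 0 ?z + m * (r - a) \<le> timer_extend T (V (\<eta> a)) \<tau> y"
      using T_pos by (simp add: timer_extend_def min_absorb2)
    have "\<exists>\<tau>'\<ge>0. (\<forall>r\<in>switching_instants \<eta>. b < r \<longrightarrow> T \<le> \<tau>' + (r - b)) \<and>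
        timer_extend T (V (\<eta> b)) \<tau>' (evolution S \<eta> b r ?z) + m * (b - r) \<le> timer_extend T (V (\<eta> r)) 0 ?z"
    proof (rule switch.IH)
      show "\<forall>r'\<in>switching_instants \<eta>. r < r' \<longrightarrow> T \<le> 0 + (r' - r)"
        using dwell switch(4) by (auto simp: dwell_at_least_def)
      fix t assume "r \<le> t" "t \<le> b"
      then show "m \<le> norm (evolution S \<eta> t r ?z) powr p"
        using switch.prems(3)[of t] later[of t] switch(2) by simp
    qed simp
    then obtain \<tau>' where "0 \<le> \<tau>'" "\<forall>r\<in>switching_instants \<eta>. b < r \<longrightarrow> T \<le> \<tau>' + (r - b)"
      "timer_extend T (V (\<eta> b)) \<tau>' (evolution S \<eta> b r ?z) + m * (b - r) \<le> timer_extend T (V (\<eta> r)) 0 ?z"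
      by blast
    moreover have "m * (b - a) = m * (b - r) + m * (r - a)" by (simp add: algebra_simps)
    ultimately show ?case
      using jump later[OF switch(3)] by (intro exI[of _ \<tau>']) auto
  qed
  then show ?thesis using that by blast
qed

text \<open>The functional along the trajectory starts at most at \<open>c * norm x powr p\<close>, does not increase
  up to time \<open>a\<close>, loses \<open>m * (b - a)\<close> from \<open>a\<close> to \<open>b\<close>, and stays nonnegative. The initial timer
  is \<open>T\<close>, because the first switch after \<open>s\<close> may come at any time.\<close>

lemma dissipation_bound:
  assumes tf: "timer_functionals S T p c V" and \<eta>: "\<eta> \<in> Sigma_min T" and "0 \<le> s" "s \<le> a" "a \<le> b"
    and m: "\<And>t. a \<le> t \<Longrightarrow> t \<le> b \<Longrightarrow> m \<le> norm (evolution S \<eta> t s x) powr p"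
  shows "m * (b - a) \<le> c * norm x powr p"
proof -
  have T_in: "T \<in> {0..T}" using T_pos by simp
  obtain \<tau> where \<tau>: "0 \<le> \<tau>" "\<forall>r\<in>switching_instants \<eta>. a < r \<longrightarrow> T \<le> \<tau> + (r - a)"
    "timer_extend T (V (\<eta> a)) \<tau> (evolution S \<eta> a s x) + 0 * (a - s) \<le> timer_extend T (V (\<eta> s)) T x"
  proof (rule timer_decrease[OF tf \<eta> \<open>0 \<le> s\<close> \<open>s \<le> a\<close>, of T 0 x])
    show "\<forall>r\<in>switching_instants \<eta>. s < r \<longrightarrow> T \<le> T + (r - s)" by simp
  qed (use T_pos in auto)
  obtain \<tau>' where \<tau>': "0 \<le> \<tau>'"
    "timer_extend T (V (\<eta> b)) \<tau>' (evolution S \<eta> b a (evolution S \<eta> a s x)) + m * (b - a) \<le>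
      timer_extend T (V (\<eta> a)) \<tau> (evolution S \<eta> a s x)"
  proof (rule timer_decrease[OF tf \<eta> _ \<open>a \<le> b\<close> \<tau>(1,2), of m "evolution S \<eta> a s x"])
    show "0 \<le> a" using assms by simp
    fix t assume "a \<le> t" "t \<le> b"
    then show "m \<le> norm (evolution S \<eta> t a (evolution S \<eta> a s x)) powr p"
      using m[of t] evolution_comp[OF \<eta> \<open>0 \<le> s\<close> \<open>s \<le> a\<close>, of t] by simp
  qed
  have "0 \<le> timer_extend T (V (\<eta> b)) \<tau>' z" for z
    using timer_nonneg[OF tf, of "min \<tau>' T"] \<tau>'(1) T_pos by (simp add: timer_extend_def)
  then have "m * (b - a) \<le> timer_extend T (V (\<eta> s)) T x"
    using \<tau>(3) \<tau>'(2) by (smt (verit, best))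
  also have "\<dots> \<le> c * norm x powr p"
    using timer_upper[OF tf T_in] by (simp add: timer_extend_def)
  finally show ?thesis .
qed

text \<open>Datko's argument, with lower bounds of the norm over windows in place of integrals. On the
  window of length \<open>T\<close> before \<open>t\<close> the norm is at least its final value divided by \<open>M\<^sup>2\<close>, and the
  dissipation bound limits such a value: this gives the uniform bound \<open>C\<close>. Knowing \<open>C\<close>, the norm
  is at least its final value divided by \<open>C\<close> on a window of any length \<open>\<theta>\<close>, and the
  dissipation bound makes the final value small when \<open>\<theta>\<close> is large.\<close>

lemma UES_if_timer_functionals:
  assumes tf: "timer_functionals S T p c V" and "1 \<le> p" "0 < c"
  shows UES
proof -
  define C where "C = max (M\<^sup>2) (M\<^sup>2 * (c / T) powr (1 / p))"
  have "1 \<le> M\<^sup>2" "0 < M\<^sup>2" using M_ge_1 by simp_all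
  then have "1 \<le> C" by (simp add: C_def)
  have bounded: "norm (evolution S \<eta> t s) \<le> C"
    if \<eta>: "\<eta> \<in> Sigma_min T" and "0 \<le> s" "s \<le> t" for \<eta> s t
  proof (cases "t - s \<le> T")
    case True
    then show ?thesis using norm_evolution_short[OF that] by (simp add: C_def)
  next
    case False
    show ?thesis
    proof (rule norm_blinfun_bound)
      show "0 \<le> C" using \<open>1 \<le> C\<close> by simp
      fix x
      let ?n = "norm (evolution S \<eta> t s x)"
      have "(?n / M\<^sup>2) powr p * (t - (t - T)) \<le> c * norm x powr p"
      proof (rule dissipation_bound[OF tf \<eta> \<open>0 \<le> s\<close>])
        fix \<sigma> assume \<sigma>: "t - T \<le> \<sigma>" "\<sigma> \<le> t"
        have "?n = norm (evolution S \<eta> t \<sigma> (evolution S \<eta> \<sigma> s x))"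
          using evolution_comp[OF \<eta> \<open>0 \<le> s\<close>, of \<sigma> t] \<sigma> False by simp
        also have "\<dots> \<le> norm (evolution S \<eta> t \<sigma>) * norm (evolution S \<eta> \<sigma> s x)" by (rule norm_blinfun)
        also have "\<dots> \<le> M\<^sup>2 * norm (evolution S \<eta> \<sigma> s x)"
          using \<sigma> False \<open>0 \<le> s\<close> by (intro mult_right_mono norm_evolution_short[OF \<eta>]) auto
        finally show "(?n / M\<^sup>2) powr p \<le> norm (evolution S \<eta> \<sigma> s x) powr p"
          using \<open>0 < M\<^sup>2\<close> \<open>1 \<le> p\<close> by (intro powr_mono2) (auto simp: pos_divide_le_eq mult.commute)
      qed (use False T_pos in auto)
      then have "?n / M\<^sup>2 \<le> (c / T) powr (1 / p) * norm x"
        using \<open>0 < c\<close> T_pos \<open>1 \<le> p\<close> by (intro powr_root_bound) auto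
      then have "?n \<le> M\<^sup>2 * (c / T) powr (1 / p) * norm x"
        using \<open>1 \<le> M\<^sup>2\<close> M_ge_1 by (simp add: field_simps)
      also have "\<dots> \<le> C * norm x" by (intro mult_right_mono) (auto simp: C_def)
      finally show "?n \<le> C * norm x" .
    qed
  qed
  \<comment> \<open>The length for which \<open>C * (c / \<theta>) powr (1 / p) = 1 / 2\<close>.\<close>
  define \<theta> where "\<theta> = c * (2 * C) powr p"
  have "0 < \<theta>" using \<open>0 < c\<close> \<open>1 \<le> C\<close> by (simp add: \<theta>_def)
  show UES
  proof (rule UES_if_contraction[OF \<open>0 < \<theta>\<close> bounded])
    fix \<eta> :: "real \<Rightarrow> 'n" and s :: real assume \<eta>: "\<eta> \<in> Sigma_min T" and "0 \<le> s"
    show "norm (evolution S \<eta> (s + \<theta>) s) \<le> 1 / 2"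
    proof (rule norm_blinfun_bound)
      fix x
      let ?n = "norm (evolution S \<eta> (s + \<theta>) s x)"
      have "(?n / C) powr p * (s + \<theta> - s) \<le> c * norm x powr p"
      proof (rule dissipation_bound[OF tf \<eta> \<open>0 \<le> s\<close>])
        fix \<sigma> assume \<sigma>: "s \<le> \<sigma>" "\<sigma> \<le> s + \<theta>"
        have "?n = norm (evolution S \<eta> (s + \<theta>) \<sigma> (evolution S \<eta> \<sigma> s x))"
          using evolution_comp[OF \<eta> \<open>0 \<le> s\<close> \<sigma>] by simp
        also have "\<dots> \<le> norm (evolution S \<eta> (s + \<theta>) \<sigma>) * norm (evolution S \<eta> \<sigma> s x)" by (rule norm_blinfun)
        also have "\<dots> \<le> C * norm (evolution S \<eta> \<sigma> s x)"
          using \<sigma> \<open>0 \<le> s\<close> by (intro mult_right_mono bounded[OF \<eta>]) auto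
        finally show "(?n / C) powr p \<le> norm (evolution S \<eta> \<sigma> s x) powr p"
          using \<open>1 \<le> C\<close> \<open>1 \<le> p\<close> by (intro powr_mono2) (auto simp: field_simps)
      qed (use \<open>0 < \<theta>\<close> in auto)
      then have "?n / C \<le> (c / \<theta>) powr (1 / p) * norm x"
        using \<open>0 < c\<close> \<open>0 < \<theta>\<close> \<open>1 \<le> p\<close> \<open>1 \<le> C\<close> by (intro powr_root_bound) auto
      also have "(c / \<theta>) powr (1 / p) = 1 / (2 * C)"
      proof -
        have "c / \<theta> = (2 * C) powr (- p)"
          using \<open>0 < c\<close> \<open>1 \<le> C\<close> by (simp add: \<theta>_def powr_minus_divide)
        then have "(c / \<theta>) powr (1 / p) = (2 * C) powr (- p * (1 / p))" by (simp only: powr_powr)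
        also have "- p * (1 / p) = - 1" using \<open>1 \<le> p\<close> by simp
        finally show ?thesis using \<open>1 \<le> C\<close> by (simp add: powr_minus_divide)
      qed
      finally show "?n \<le> 1 / 2 * norm x" using \<open>1 \<le> C\<close> by (simp add: field_simps)
    qed simp
  qed
qed

end

section \<open>Delayed signals\<close>

text \<open>The signal that stays in mode \<open>i\<close> up to time \<open>h\<close> and then replays \<open>\<eta>\<close>. It switches at
  \<open>h\<close> exactly if \<open>\<eta>\<close> does not start in mode \<open>i\<close>. So the time origin, which never counts as
  a switching instant, can become one, and a single construction covers both the passage of time
  within a mode and a switch into another mode.\<close>

definition prepend :: "real \<Rightarrow> 'n \<Rightarrow> (real \<Rightarrow> 'n) \<Rightarrow> real \<Rightarrow> 'n" where
  "prepend h i \<eta> u = (if u < h then i else \<eta> (u - h))"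

lemma eventually_at_left_shift:
  "eventually P (at_left (r + h)) \<longleftrightarrow> (\<forall>\<^sub>F u in at_left r. P (u + h))" for r h :: real
proof -
  have "at_left (r + h) = filtermap (\<lambda>u. u + h) (at_left r)"
    using filtermap_at_left_shift[of "- h" r] by simp
  then show ?thesis by (simp add: eventually_filtermap)
qed

lemma eventually_at_right_shift:
  "eventually P (at_right (r + h)) \<longleftrightarrow> (\<forall>\<^sub>F u in at_right r. P (u + h))" for r h :: real
proof -
  have "at_right (r + h) = filtermap (\<lambda>u. u + h) (at_right r)"
    using filtermap_at_right_shift[of "- h" r] by simp
  then show ?thesis by (simp add: eventually_filtermap)
qed

lemma prepend_shift: "0 \<le> u \<Longrightarrow> prepend h i \<eta> (u + h) = \<eta> u"
  by (simp add: prepend_def)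

lemma switching_instants_prepend:
  assumes "0 < h"
  shows "switching_instants (prepend h i \<eta>) =
    (if \<eta> 0 = i then {} else {h}) \<union> (\<lambda>r. r + h) ` switching_instants \<eta>"
proof (intro set_eqI)
  fix t
  let ?p = "prepend h i \<eta>"
  have before: "\<forall>\<^sub>F s in at_left t. ?p s = i" if "0 < t" "t \<le> h"
  proof -
    have "\<forall>\<^sub>F s in at_left t. s \<in> {0<..<t}" 
      using \<open>0 < t\<close> by (intro eventually_at_leftI[of 0]) auto
    then show ?thesis by eventually_elim (use \<open>t \<le> h\<close> in \<open>simp add: prepend_def\<close>)
  qed
  have after: "t \<in> switching_instants ?p \<longleftrightarrow> t - h \<in> switching_instants \<eta>" if "h < t"
  proof -
    have "(\<forall>\<^sub>F s in at_left t. ?p s = ?p t) \<longleftrightarrow> (\<forall>\<^sub>F s in at_left (t - h). ?p (s + h) = ?p t)"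
      using eventually_at_left_shift[of _ "t - h" h] by simp
    also have "\<dots> \<longleftrightarrow> (\<forall>\<^sub>F s in at_left (t - h). \<eta> s = \<eta> (t - h))"
    proof (rule eventually_cong)
      show "\<forall>\<^sub>F s in at_left (t - h). s \<in> {0<..<t - h}"
        using that by (intro eventually_at_leftI[of 0]) auto
    qed (use that in \<open>auto simp: prepend_def\<close>)
    finally show ?thesis using that assms by (simp add: switching_instants_def)
  qed
  have pos: "0 < r" if "r \<in> switching_instants \<eta>" for r
    using that by (simp add: switching_instants_def)
  consider "t \<le> 0" | "0 < t" "t < h" | "t = h" | "h < t" by linarith
  then show "t \<in> switching_instants ?p \<longleftrightarrow>
    t \<in> (if \<eta> 0 = i then {} else {h}) \<union> (\<lambda>r. r + h) ` switching_instants \<eta>"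
  proof cases
    case 1
    then show ?thesis using assms pos by (force simp: switching_instants_def[of ?p])
  next
    case 2
    then show ?thesis using before pos by (force simp: switching_instants_def[of ?p] prepend_def)
  next
    case 3
    have "(\<forall>\<^sub>F s in at_left h. ?p s = ?p h) \<longleftrightarrow> \<eta> 0 = i"
    proof
      assume "\<forall>\<^sub>F s in at_left h. ?p s = ?p h"
      then have "\<forall>\<^sub>F s in at_left h. ?p h = i"
        using before[unfolded 3, OF assms order_refl] by eventually_elim simp
      then show "\<eta> 0 = i" by (simp add: prepend_def)
    next
      assume "\<eta> 0 = i"
      then show "\<forall>\<^sub>F s in at_left h. ?p s = ?p h"
        using before[unfolded 3, OF assms order_refl] by (simp add: prepend_def)
    qed
    then show ?thesis using pos[of 0] assms 3 by (auto simp: switching_instants_def[of ?p])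
  next
    case 4
    then have "t \<in> (\<lambda>r. r + h) ` switching_instants \<eta> \<longleftrightarrow> t - h \<in> switching_instants \<eta>"
      by (auto intro: image_eqI[of _ _ "t - h"])
    then show ?thesis using after 4 by auto
  qed
qed

lemma switching_signal_prepend:
  assumes "0 < h" and sig: "switching_signal \<eta>"
  shows "switching_signal (prepend h i \<eta>)"
  unfolding switching_signal_def
proof (intro conjI allI impI)
  fix t :: real assume "0 \<le> t"
  show "\<forall>\<^sub>F s in at_right t. prepend h i \<eta> s = prepend h i \<eta> t"
  proof (cases "t < h")
    case True
    have "\<forall>\<^sub>F s in at_right t. s \<in> {t<..<h}"
      using True by (intro eventually_at_rightI[of _ h]) auto
    then show ?thesis by eventually_elim (use True in \<open>simp add: prepend_def\<close>)
  next
    case False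
    then have "\<forall>\<^sub>F s in at_right (t - h). \<eta> s = \<eta> (t - h)"
      using sig by (simp add: switching_signal_def)
    moreover have "\<forall>\<^sub>F s in at_right (t - h). t - h < s" by (rule eventually_at_right_less)
    ultimately have "\<forall>\<^sub>F s in at_right (t - h). prepend h i \<eta> (s + h) = prepend h i \<eta> t"
      by eventually_elim (use False in \<open>simp add: prepend_def\<close>)
    then show ?thesis using eventually_at_right_shift[of _ "t - h" h] by simp
  qed
next
  fix b
  have "switching_instants (prepend h i \<eta>) \<inter> {0..b} \<subseteq>
    insert h ((\<lambda>r. r + h) ` (switching_instants \<eta> \<inter> {0..b}))"
    using \<open>0 < h\<close> unfolding switching_instants_prepend[OF \<open>0 < h\<close>]
    by (auto simp: switching_instants_def)
  then show "finite (switching_instants (prepend h i \<eta>) \<inter> {0..b})"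
    using sig by (rule_tac finite_subset) (auto simp: switching_signal_def)
qed

lemma switched_product_shift:
  assumes "\<And>u. 0 \<le> u \<Longrightarrow> \<eta>' (u + h) = \<eta> u" and "0 \<le> s" "\<forall>r\<in>set rs. 0 \<le> r"
  shows "switched_product S \<eta>' (t + h) (s + h) (map (\<lambda>r. r + h) rs) = switched_product S \<eta> t s rs"
  using assms(2,3) by (induction rs arbitrary: s) (simp_all add: assms(1))

lemma sorted_list_of_set_shift:
  fixes h :: real
  assumes "finite A"
  shows "sorted_list_of_set ((\<lambda>r. r + h) ` A) = map (\<lambda>r. r + h) (sorted_list_of_set A)"
proof (rule sorted_list_of_set.sorted_key_list_of_set_unique[THEN iffD1])
qed (use assms in \<open>auto simp: card_image inj_on_def sorted_wrt_map\<close>)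

lemma evolution_prepend_after:
  assumes sg: "\<And>i. C0_semigroup (S i)" and "0 < h" and sig: "switching_signal \<eta>" and "0 \<le> t"
  shows "evolution S (prepend h i \<eta>) (t + h) 0 = evolution S \<eta> t 0 o\<^sub>L S i h"
proof -
  let ?p = "prepend h i \<eta>"
  note sw = switching_instants_prepend[OF \<open>0 < h\<close>, of i \<eta>]
  have sigp: "switching_signal ?p" using switching_signal_prepend[OF \<open>0 < h\<close> sig] .
  have pos: "0 < r" if "r \<in> switching_instants \<eta>" for r
    using that by (simp add: switching_instants_def)
  have "switching_instants ?p \<inter> {0 + h<..t + h} = (\<lambda>r. r + h) ` (switching_instants \<eta> \<inter> {0<..t})"
    unfolding sw using pos by auto
  then have "evolution S ?p (t + h) (0 + h) = evolution S \<eta> t 0"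
    unfolding evolution_def
    using sorted_list_of_set_shift[OF finite_switching_instants[OF sig order_refl], of h t]
      switched_product_shift[of ?p h \<eta> 0 "sorted_list_of_set (switching_instants \<eta> \<inter> {0<..t})" S t]
      finite_switching_instants[OF sig order_refl, of t]
    by (auto simp: prepend_shift)
  moreover have "evolution S ?p h 0 = S i h"
  proof (cases "\<eta> 0 = i")
    case True
    then have "switching_instants ?p \<inter> {0<..h} = {}" unfolding sw by (fastforce dest: pos)
    then show ?thesis using \<open>0 < h\<close> by (simp add: evolution_no_switch prepend_def)
  next
    case False
    then have "h \<in> switching_instants ?p" "switching_instants ?p \<inter> {0<..<h} = {}"
      unfolding sw by (fastforce dest: pos)+
    then have "evolution S ?p h 0 = evolution S ?p h h o\<^sub>L S (?p 0) (h - 0)"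
      using \<open>0 < h\<close> by (intro evolution_first_switch[OF sigp]) auto
    then show ?thesis using sg \<open>0 < h\<close> by (simp add: evolution_refl prepend_def blinfun_eqI)
  qed
  ultimately show ?thesis
    using evolution_compose[OF sg sigp, of 0 h "t + h"] \<open>0 < h\<close> \<open>0 \<le> t\<close> by simp
qed

lemma evolution_prepend_before:
  assumes "0 \<le> t" "t < h"
  shows "evolution S (prepend h i \<eta>) t 0 = S i t"
proof -
  have "switching_instants (prepend h i \<eta>) \<inter> {0<..t} = {}"
    using assms by (subst switching_instants_prepend) (auto simp: switching_instants_def)
  then show ?thesis using assms by (simp add: evolution_no_switch prepend_def)
qed

section \<open>The witness functional\<close>

text \<open>The mean value theorem. The power is differentiable inside the interval and continuous up to
  its end points, of which the smaller may be \<open>0\<close>.\<close>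

lemma powr_difference_bound:
  fixes a b R p :: real
  assumes "0 \<le> a" "a \<le> R" "0 \<le> b" "b \<le> R" "1 \<le> p"
  shows "a powr p \<le> b powr p + p * R powr (p - 1) * \<bar>a - b\<bar>"
proof (cases "a \<le> b")
  case True
  then have "a powr p \<le> b powr p" using assms by (intro powr_mono2) auto
  moreover have "0 \<le> p * R powr (p - 1) * \<bar>a - b\<bar>" using assms by simp
  ultimately show ?thesis by linarith
next
  case False
  then have "b < a" by simp
  have "continuous_on {b..a} (\<lambda>x. x powr p)"
    using assms by (intro continuous_on_powr' continuous_intros) auto
  moreover have "((\<lambda>x. x powr p) has_derivative (\<lambda>h. p * x powr (p - 1) * h)) (at x)" if "b < x" for x
    using has_real_derivative_powr[of x p] that assms by (simp add: has_field_derivative_def)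
  ultimately obtain z where z: "b < z" "z < a" "a powr p - b powr p = p * z powr (p - 1) * (a - b)"
    using mvt[OF \<open>b < a\<close>, of "\<lambda>x. x powr p" "\<lambda>x h. p * x powr (p - 1) * h"] by blast
  have "z powr (p - 1) \<le> R powr (p - 1)" using z assms by (intro powr_mono2) auto
  then have "p * z powr (p - 1) * (a - b) \<le> p * R powr (p - 1) * (a - b)"
    using \<open>b < a\<close> assms by (intro mult_right_mono mult_left_mono) auto
  with z(3) show ?thesis using \<open>b < a\<close> by simp
qed

lemma nn_integral_exp_decay:
  fixes \<gamma> c :: real
  assumes "0 < \<gamma>" "0 \<le> c"
  shows "(\<integral>\<^sup>+ s\<in>{0..}. ennreal (c * exp (- \<gamma> * s)) \<partial>lborel) = ennreal (c / \<gamma>)"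
proof -
  have "(\<integral>\<^sup>+ s. ennreal (c * exp (- \<gamma> * s)) * indicator {0..} s \<partial>lborel) =
      ennreal (0 - (- (c / \<gamma>) * exp (- \<gamma> * 0)))"
  proof (rule nn_integral_FTC_atLeast)
    show "((\<lambda>s. - (c / \<gamma>) * exp (- \<gamma> * s)) has_real_derivative c * exp (- \<gamma> * s)) (at s)" for s
      using assms by (auto intro!: derivative_eq_intros simp: field_simps)
    have "((\<lambda>s. exp (- \<gamma> * s)) \<longlongrightarrow> 0) at_top"
      using assms
      by (intro filterlim_compose[OF exp_at_bot] filterlim_tendsto_neg_mult_at_bot[OF tendsto_const] filterlim_ident) auto
    then show "((\<lambda>s. - (c / \<gamma>) * exp (- \<gamma> * s)) \<longlongrightarrow> 0) at_top"
      by (rule tendsto_mult_right_zero)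
  qed (use assms in auto)
  then show ?thesis by simp
qed

lemma Sigma_future_subset: "Sigma_future T i \<tau> \<subseteq> Sigma_min T"
  by (auto simp: Sigma_future_def Sigma_min_def)

lemma Sigma_future_nonempty: "Sigma_future T i \<tau> \<noteq> {}"
proof -
  have "switching_instants (\<lambda>_. i) = {}" by (simp add: switching_instants_def)
  then have "(\<lambda>_. i) \<in> Sigma_future T i \<tau>"
    by (simp add: Sigma_future_def switching_signal_def dwell_at_least_def)
  then show ?thesis by blast
qed

lemma Sigma_future_mono: "\<tau> \<le> \<tau>' \<Longrightarrow> Sigma_future T i \<tau> \<subseteq> Sigma_future T i \<tau>'"
  by (fastforce simp: Sigma_future_def)

lemma Sigma_future_min: "Sigma_future T i (min \<tau> T) = Sigma_future T i \<tau>"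
proof -
  have "max (T - min \<tau> T) 0 = max (T - \<tau>) 0" by auto
  then show ?thesis unfolding Sigma_future_def by simp
qed

text \<open>If the mode does not change at \<open>h\<close>, the timer has run from \<open>\<tau>\<close> to \<open>\<tau> + h\<close>, and
  \<open>\<sigma>\<close> may be smaller because a shorter elapsed dwell only restricts the future. If the
  mode changes at \<open>h\<close>, the timer must be saturated there and restarts at \<open>0\<close>.\<close>

lemma prepend_in_Sigma_future:
  assumes "0 < h" "0 < T" and \<eta>: "\<eta> \<in> Sigma_future T j \<sigma>"
    and "i = j \<and> \<sigma> \<le> \<tau> + h \<or> i \<noteq> j \<and> \<sigma> = 0 \<and> T \<le> \<tau> + h"
  shows "prepend h i \<eta> \<in> Sigma_future T i \<tau>"
proof -
  have sig: "switching_signal \<eta>" and [simp]: "\<eta> 0 = j" and dwell: "dwell_at_least T \<eta>"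
    and first: "\<And>r. r \<in> switching_instants \<eta> \<Longrightarrow> T - \<sigma> \<le> r \<and> 0 \<le> r"
    using \<eta> by (auto simp: Sigma_future_def)
  note sw = switching_instants_prepend[OF \<open>0 < h\<close>, of i \<eta>]
  have dw: "T \<le> r' - r" if "r \<in> switching_instants \<eta>" "r' \<in> switching_instants \<eta>" "r < r'" for r r'
    using dwell that by (simp add: dwell_at_least_def)
  have "dwell_at_least T (prepend h i \<eta>)"
    unfolding dwell_at_least_def sw using assms(4) by (auto dest: first dw split: if_splits)
  moreover have "max (T - \<tau>) 0 \<le> r" if "r \<in> switching_instants (prepend h i \<eta>)" for r
    using that assms(4) \<open>0 < h\<close> \<open>0 < T\<close> unfolding sw by (auto dest: first split: if_splits)
  ultimately show ?thesis
    using switching_signal_prepend[OF \<open>0 < h\<close> sig] \<open>0 < h\<close>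
    by (simp add: Sigma_future_def prepend_def[of h i \<eta> 0])
qed

locale exponentially_stable_switching = stable_modes S T M \<omega>
  for S :: "'n::finite \<Rightarrow> real \<Rightarrow> 'a::banach \<Rightarrow>\<^sub>L 'a" and T M \<omega> +
  fixes K \<beta> p :: real
  assumes K_ge_1: "1 \<le> K" and \<beta>_pos: "0 < \<beta>" and p_ge_1: "1 \<le> p"
    and evolution_decay: "\<eta> \<in> Sigma_min T \<Longrightarrow> 0 \<le> t \<Longrightarrow>
      norm (evolution S \<eta> t 0) \<le> K * exp (- \<beta> * t)"
begin

definition cost :: "(real \<Rightarrow> 'n) \<Rightarrow> 'a \<Rightarrow> ennreal" where
  "cost \<eta> x = (\<integral>\<^sup>+ s\<in>{0..}. ennreal (norm (evolution S \<eta> s 0 x) powr p) \<partial>lborel)"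

abbreviation W :: "'n \<Rightarrow> real \<Rightarrow> 'a \<Rightarrow> ennreal" where
  "W \<equiv> witness_functional S T p"

lemma W_eq: "W i \<tau> x = (SUP \<eta>\<in>Sigma_future T i \<tau>. cost \<eta> x)"
  by (simp add: witness_functional_def cost_def)

lemma cost_le_W: "\<eta> \<in> Sigma_future T i \<tau> \<Longrightarrow> cost \<eta> x \<le> W i \<tau> x"
  unfolding W_eq by (rule SUP_upper)

lemma trajectory_decay:
  assumes "\<eta> \<in> Sigma_min T" "0 \<le> t"
  shows "norm (evolution S \<eta> t 0 x) \<le> K * exp (- \<beta> * t) * norm x"
  by (rule order_trans[OF norm_blinfun]) (intro mult_right_mono evolution_decay assms norm_ge_zero)

lemma cost_integrand_measurable:
  assumes "\<eta> \<in> Sigma_min T"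
  shows "(\<lambda>s. ennreal (norm (evolution S \<eta> s 0 x) powr p) * indicator {0..} s) \<in> borel_measurable borel"
proof -
  have "continuous_on {0..} (\<lambda>s. norm (evolution S \<eta> s 0 x) powr p)"
    using assms p_ge_1
    by (intro continuous_on_powr' continuous_intros continuous_on_norm evolution_continuous)
      (auto simp: Sigma_min_def)
  then have "(\<lambda>s. indicator {0..} s *\<^sub>R (norm (evolution S \<eta> s 0 x) powr p)) \<in> borel_measurable borel"
    by (intro borel_measurable_continuous_on_indicator) auto
  then have "(\<lambda>s. ennreal (indicator {0..} s *\<^sub>R (norm (evolution S \<eta> s 0 x) powr p))) \<in> borel_measurable borel"
    by measurable
  also have "(\<lambda>s. ennreal (indicator {0..} s *\<^sub>R (norm (evolution S \<eta> s 0 x) powr p))) =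
      (\<lambda>s. ennreal (norm (evolution S \<eta> s 0 x) powr p) * indicator {0..} s)"
    by (auto simp: indicator_def)
  finally show ?thesis .
qed

lemma cost_bound:
  assumes "\<eta> \<in> Sigma_min T"
  shows "cost \<eta> x \<le> ennreal (K powr p / (\<beta> * p) * norm x powr p)"
proof -
  have "cost \<eta> x \<le> (\<integral>\<^sup>+ s\<in>{0..}. ennreal (K powr p * norm x powr p * exp (- (\<beta> * p) * s)) \<partial>lborel)"
    unfolding cost_def
  proof (rule nn_integral_mono)
    fix s :: real
    have "norm (evolution S \<eta> s 0 x) powr p \<le> K powr p * norm x powr p * exp (- (\<beta> * p) * s)"
      if "0 \<le> s"
    proof -
      have "norm (evolution S \<eta> s 0 x) powr p \<le> (K * exp (- \<beta> * s) * norm x) powr p"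
        using trajectory_decay[OF assms that] p_ge_1 by (intro powr_mono2) auto
      also have "\<dots> = K powr p * norm x powr p * exp (- (\<beta> * p) * s)"
        using K_ge_1 by (simp add: powr_mult exp_powr_real algebra_simps)
      finally show ?thesis .
    qed
    then show "ennreal (norm (evolution S \<eta> s 0 x) powr p) * indicator {0..} s \<le>
        ennreal (K powr p * norm x powr p * exp (- (\<beta> * p) * s)) * indicator {0..} s"
      by (cases "0 \<le> s") (simp_all add: ennreal_leI)
  qed
  also have "\<dots> = ennreal (K powr p * norm x powr p / (\<beta> * p))"
    using \<beta>_pos p_ge_1 by (intro nn_integral_exp_decay) auto
  finally show ?thesis by simp
qed

lemma W_bound: "W i \<tau> x \<le> ennreal (K powr p / (\<beta> * p) * norm x powr p)"
  unfolding W_eq using Sigma_future_subset by (intro SUP_least cost_bound) blast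

lemma W_finite: "W i \<tau> x < \<infinity>"
  using W_bound[of i \<tau> x] by (simp add: le_less_trans)

lemma W_eq_ennreal: "W i \<tau> x = ennreal (enn2real (W i \<tau> x))"
  using W_finite[of i \<tau> x] by simp

text \<open>Both trajectories stay below \<open>K * exp (- \<beta> * s) * r\<close> and differ by at most
  \<open>K * exp (- \<beta> * s) * norm (x - y)\<close>. The pointwise Lipschitz bound of the power therefore
  inherits the integrable factor \<open>exp (- (\<beta> * p) * s)\<close>.\<close>

lemma cost_lipschitz:
  assumes \<eta>: "\<eta> \<in> Sigma_min T" and "norm x < r" "norm y < r"
  shows "cost \<eta> x \<le> cost \<eta> y + ennreal (K powr p * r powr (p - 1) / \<beta> * norm (x - y))"
proof -
  let ?\<Phi> = "\<lambda>s. evolution S \<eta> s 0"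
  let ?c = "p * K powr p * r powr (p - 1) * norm (x - y)"
  have "0 < r" using \<open>norm x < r\<close> norm_ge_zero[of x] by linarith
  have pointwise: "norm (?\<Phi> s x) powr p \<le> norm (?\<Phi> s y) powr p + ?c * exp (- (\<beta> * p) * s)"
    if "0 \<le> s" for s
  proof -
    define e where "e = K * exp (- \<beta> * s)"
    have "0 < e" using K_ge_1 by (simp add: e_def)
    have le: "norm (?\<Phi> s z) \<le> e * norm z" for z
      using trajectory_decay[OF \<eta> that, of z] by (simp add: e_def)
    have le_r: "norm (?\<Phi> s z) \<le> e * r" if "norm z < r" for z
      using le[of z] mult_left_mono[of "norm z" r e] that \<open>0 < e\<close> by linarith
    have "norm (?\<Phi> s x) powr p \<le> norm (?\<Phi> s y) powr p +
        p * (e * r) powr (p - 1) * \<bar>norm (?\<Phi> s x) - norm (?\<Phi> s y)\<bar>"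
      using assms p_ge_1 by (intro powr_difference_bound le_r) auto
    also have "\<bar>norm (?\<Phi> s x) - norm (?\<Phi> s y)\<bar> \<le> e * norm (x - y)"
      using norm_triangle_ineq3[of "?\<Phi> s x" "?\<Phi> s y"] le[of "x - y"] by (simp add: blinfun.diff_right)
    then have "p * (e * r) powr (p - 1) * \<bar>norm (?\<Phi> s x) - norm (?\<Phi> s y)\<bar> \<le>
        p * (e * r) powr (p - 1) * (e * norm (x - y))"
      using p_ge_1 by (intro mult_left_mono) auto
    also have "p * (e * r) powr (p - 1) * (e * norm (x - y)) =
        p * (e powr (p - 1) * e) * r powr (p - 1) * norm (x - y)"
      using \<open>0 < e\<close> \<open>0 < r\<close> by (simp add: powr_mult)
    also have "e powr (p - 1) * e = K powr p * exp (- (\<beta> * p) * s)"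
    proof -
      have "e powr (p - 1) * e = e powr p" using \<open>0 < e\<close> powr_add[of e "p - 1" 1] by simp
      then show ?thesis unfolding e_def using K_ge_1 by (simp add: powr_mult exp_powr_real algebra_simps)
    qed
    finally show ?thesis by (simp add: ac_simps)
  qed
  have "0 \<le> ?c" using p_ge_1 by simp
  have "cost \<eta> x \<le> (\<integral>\<^sup>+ s. ennreal (norm (?\<Phi> s y) powr p) * indicator {0..} s +
      ennreal (?c * exp (- (\<beta> * p) * s)) * indicator {0..} s \<partial>lborel)"
    unfolding cost_def
  proof (rule nn_integral_mono)
    fix s
    show "ennreal (norm (?\<Phi> s x) powr p) * indicator {0..} s \<le>
        ennreal (norm (?\<Phi> s y) powr p) * indicator {0..} s +
        ennreal (?c * exp (- (\<beta> * p) * s)) * indicator {0..} s"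
      using ennreal_leI[OF pointwise[of s]] \<open>0 \<le> ?c\<close>
      by (cases "0 \<le> s") (simp_all add: ennreal_plus[symmetric] del: ennreal_plus)
  qed
  also have "\<dots> = cost \<eta> y + (\<integral>\<^sup>+ s\<in>{0..}. ennreal (?c * exp (- (\<beta> * p) * s)) \<partial>lborel)"
    unfolding cost_def using cost_integrand_measurable[OF \<eta>, of y] by (intro nn_integral_add) auto
  also have "(\<integral>\<^sup>+ s\<in>{0..}. ennreal (?c * exp (- (\<beta> * p) * s)) \<partial>lborel) = ennreal (?c / (\<beta> * p))"
    using \<beta>_pos p_ge_1 \<open>0 \<le> ?c\<close> by (intro nn_integral_exp_decay) auto
  also have "?c / (\<beta> * p) = K powr p * r powr (p - 1) / \<beta> * norm (x - y)"
    using p_ge_1 by (simp add: field_simps)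
  finally show ?thesis .
qed

abbreviation V :: "'n \<Rightarrow> real \<Rightarrow> 'a \<Rightarrow> real" where
  "V i \<tau> x \<equiv> enn2real (W i \<tau> x)"

lemma V_lipschitz:
  assumes "norm x < r" "norm y < r"
  shows "V i \<tau> x \<le> V i \<tau> y + K powr p * r powr (p - 1) / \<beta> * norm (x - y)"
proof -
  let ?c = "K powr p * r powr (p - 1) / \<beta> * norm (x - y)"
  have "0 \<le> ?c" using \<beta>_pos by simp
  have "W i \<tau> x \<le> W i \<tau> y + ennreal ?c"
    unfolding W_eq[of i \<tau> x]
  proof (rule SUP_least)
    fix \<eta> assume "\<eta> \<in> Sigma_future T i \<tau>"
    then have "cost \<eta> x \<le> cost \<eta> y + ennreal ?c" "cost \<eta> y \<le> W i \<tau> y"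
      using cost_lipschitz[OF _ assms] Sigma_future_subset cost_le_W by blast+
    then show "cost \<eta> x \<le> W i \<tau> y + ennreal ?c" by (meson add_right_mono order_trans)
  qed
  then have "ennreal (V i \<tau> x) \<le> ennreal (V i \<tau> y + ?c)"
    using \<open>0 \<le> ?c\<close> by (simp add: W_eq_ennreal[symmetric])
  then show ?thesis using \<open>0 \<le> ?c\<close> by (subst (asm) ennreal_le_iff) auto
qed

text \<open>The integral splits at time \<open>h\<close>; the tail is a translate of the integral for \<open>\<eta>\<close>.\<close>

lemma cost_prepend:
  assumes "0 < h" and \<eta>: "\<eta> \<in> Sigma_min T" and p\<eta>: "prepend h i \<eta> \<in> Sigma_min T"
    and m: "\<And>s. 0 \<le> s \<Longrightarrow> s \<le> h \<Longrightarrow> m \<le> norm (S i s x) powr p"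
  shows "ennreal (m * h) + cost \<eta> (S i h x) \<le> cost (prepend h i \<eta>) x"
proof -
  let ?f = "\<lambda>s. ennreal (norm (evolution S (prepend h i \<eta>) s 0 x) powr p)"
  let ?g = "\<lambda>s. ennreal (norm (evolution S \<eta> s 0 (S i h x)) powr p) * indicator {0..} s"
  have sig: "switching_signal \<eta>" using \<eta> by (simp add: Sigma_min_def)
  have g: "?g \<in> borel_measurable borel" by (rule cost_integrand_measurable[OF \<eta>])
  have "(\<integral>\<^sup>+ s. ?g s \<partial>lborel) = (\<integral>\<^sup>+ s. ?g (- h + 1 * s) \<partial>lborel)"
    using nn_integral_real_affine[OF g, of 1 "- h"] by simp
  then have "cost \<eta> (S i h x) = (\<integral>\<^sup>+ s. ?g (s - h) \<partial>lborel)"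
    by (simp add: cost_def)
  moreover have "ennreal (m * h) = (\<integral>\<^sup>+ s. ennreal m * indicator {0..<h} s \<partial>lborel)"
    using \<open>0 < h\<close> by (simp add: nn_integral_cmult_indicator ennreal_mult'')
  ultimately have "ennreal (m * h) + cost \<eta> (S i h x) =
      (\<integral>\<^sup>+ s. ennreal m * indicator {0..<h} s + ?g (s - h) \<partial>lborel)"
    using g by (simp add: nn_integral_add)
  also have "\<dots> \<le> (\<integral>\<^sup>+ s. ?f s * indicator {0..} s \<partial>lborel)"
  proof (rule nn_integral_mono)
    fix s
    consider "s < 0" | "0 \<le> s" "s < h" | "h \<le> s" by linarith
    then show "ennreal m * indicator {0..<h} s + ?g (s - h) \<le> ?f s * indicator {0..} s"
    proof cases
      case 1
      then show ?thesis using \<open>0 < h\<close> by simp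
    next
      case 2
      then show ?thesis using evolution_prepend_before[OF 2, where S = S] m[of s] by (simp add: ennreal_leI)
    next
      case 3
      then show ?thesis
        using evolution_prepend_after[OF semigroup \<open>0 < h\<close> sig, of "s - h"] \<open>0 < h\<close> by simp
    qed
  qed
  finally show ?thesis by (simp add: cost_def)
qed

text \<open>The dynamic programming inequality: running mode \<open>i\<close> for time \<open>h\<close> and then continuing
  optimally is one admissible choice. The case \<open>i = j\<close> serves the Dini inequality and continuity
  in the timer, the case \<open>i \<noteq> j\<close> the jump inequality.\<close>

lemma V_step:
  assumes "0 < h" "0 \<le> m"
    and "i = j \<and> \<sigma> \<le> \<tau> + h \<or> i \<noteq> j \<and> \<sigma> = 0 \<and> T \<le> \<tau> + h"
    and m: "\<And>s. 0 \<le> s \<Longrightarrow> s \<le> h \<Longrightarrow> m \<le> norm (S i s x) powr p"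
  shows "m * h + V j \<sigma> (S i h x) \<le> V i \<tau> x"
proof -
  have "ennreal (m * h) + W j \<sigma> (S i h x) = (SUP \<eta>\<in>Sigma_future T j \<sigma>. ennreal (m * h) + cost \<eta> (S i h x))"
    unfolding W_eq by (rule ennreal_SUP_add_right[OF Sigma_future_nonempty])
  also have "\<dots> \<le> W i \<tau> x"
  proof (rule SUP_least)
    fix \<eta> assume \<eta>: "\<eta> \<in> Sigma_future T j \<sigma>"
    then have p\<eta>: "prepend h i \<eta> \<in> Sigma_future T i \<tau>"
      using prepend_in_Sigma_future[OF \<open>0 < h\<close> T_pos _ assms(3)] by blast
    have "ennreal (m * h) + cost \<eta> (S i h x) \<le> cost (prepend h i \<eta>) x"
      using \<eta> p\<eta> Sigma_future_subset m by (intro cost_prepend[OF \<open>0 < h\<close>]) blast+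
    also have "\<dots> \<le> W i \<tau> x" using p\<eta> by (rule cost_le_W)
    finally show "ennreal (m * h) + cost \<eta> (S i h x) \<le> W i \<tau> x" .
  qed
  finally have "ennreal (m * h + V j \<sigma> (S i h x)) \<le> ennreal (V i \<tau> x)"
    using assms(1,2) by (simp add: W_eq_ennreal[symmetric])
  then show ?thesis by (subst (asm) ennreal_le_iff) auto
qed

lemma V_mono: "\<tau> \<le> \<tau>' \<Longrightarrow> V i \<tau> x \<le> V i \<tau>' x"
  using W_finite[of i \<tau>' x] unfolding W_eq
  by (intro enn2real_mono SUP_subset_mono Sigma_future_mono) auto

lemma W_min: "W i (min \<tau> T) x = W i \<tau> x"
  by (simp add: W_eq Sigma_future_min)

text \<open>Replacing \<open>x\<close> by \<open>S i h x\<close> for small \<open>h\<close> costs little, with \<open>\<delta>\<close> independent of the mode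
  and of the timer value of the functional, since the Lipschitz constant is.\<close>

lemma V_near_start:
  assumes "0 < \<epsilon>"
  obtains \<delta> where "0 < \<delta>"
    "\<And>j \<sigma> h. 0 \<le> h \<Longrightarrow> h < \<delta> \<Longrightarrow> V j \<sigma> x \<le> V j \<sigma> (S i h x) + \<epsilon>"
proof -
  define r where "r = M * norm x + 1"
  define L where "L = K powr p * r powr (p - 1) / \<beta>"
  have "norm x \<le> M * norm x" using norm_orbit_le[of 0 i x] by simp
  then have x: "norm x < r" by (simp add: r_def)
  then have "0 < r" using norm_ge_zero[of x] by linarith
  then have "0 < L" using \<beta>_pos K_ge_1 by (simp add: L_def)
  with \<open>0 < \<epsilon>\<close> obtain \<delta> where \<delta>: "0 < \<delta>" "\<And>h. 0 \<le> h \<Longrightarrow> h < \<delta> \<Longrightarrow> norm (S i h x - x) < \<epsilon> / L"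
    using orbit_uniformly_continuous[of "\<epsilon> / L" i x] by auto
  show ?thesis
  proof (rule that[OF \<delta>(1)])
    fix j \<sigma> h assume h: "0 \<le> h" "h < \<delta>"
    have "norm (S i h x) < r" using norm_orbit_le[OF h(1), of i x] by (simp add: r_def)
    from V_lipschitz[OF x this, of j \<sigma>]
    have "V j \<sigma> x \<le> V j \<sigma> (S i h x) + L * norm (S i h x - x)"
      by (simp add: L_def norm_minus_commute)
    also have "L * norm (S i h x - x) \<le> \<epsilon>" using \<delta>(2)[OF h] \<open>0 < L\<close> by (simp add: field_simps)
    finally show "V j \<sigma> x \<le> V j \<sigma> (S i h x) + \<epsilon>" by simp
  qed
qed

text \<open>More elapsed dwell admits more signals, so the functional is nondecreasing in the timer. In
  the other direction, \<open>V_step\<close> bounds the value at the later timer and the state \<open>S i h x\<close> by the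
  value at the earlier timer and the state \<open>x\<close>.\<close>

lemma V_continuous: "continuous_on {0..T} (\<lambda>\<tau>. V i \<tau> x)"
  unfolding continuous_on_iff
proof (intro ballI allI impI)
  fix \<tau> \<epsilon> :: real assume "\<tau> \<in> {0..T}" "0 < \<epsilon>"
  then obtain \<delta> where \<delta>: "0 < \<delta>"
    "\<And>j \<sigma> h. 0 \<le> h \<Longrightarrow> h < \<delta> \<Longrightarrow> V j \<sigma> x \<le> V j \<sigma> (S i h x) + \<epsilon> / 2"
    using V_near_start[of "\<epsilon> / 2" x i] by auto
  have close: "V i a x \<le> V i b x" "V i b x < V i a x + \<epsilon>" if "a \<le> b" "b - a < \<delta>" for a b
  proof -
    show "V i a x \<le> V i b x" using that(1) by (rule V_mono)
    show "V i b x < V i a x + \<epsilon>"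
    proof (cases "a = b")
      case False
      then have "0 * (b - a) + V i b (S i (b - a) x) \<le> V i a x" using that by (intro V_step) auto
      then show ?thesis using \<delta>(2)[of "b - a" i b] that \<open>0 < \<epsilon>\<close> by simp
    qed (use \<open>0 < \<epsilon>\<close> in simp)
  qed
  show "\<exists>\<delta>>0. \<forall>\<sigma>\<in>{0..T}. dist \<sigma> \<tau> < \<delta> \<longrightarrow> dist (V i \<sigma> x) (V i \<tau> x) < \<epsilon>"
  proof (intro exI[of _ \<delta>] conjI ballI impI \<delta>(1))
    fix \<sigma> assume "dist \<sigma> \<tau> < \<delta>"
    then show "dist (V i \<sigma> x) (V i \<tau> x) < \<epsilon>"
      using close[of \<sigma> \<tau>] close[of \<tau> \<sigma>] by (cases "\<sigma> \<le> \<tau>") (auto simp: dist_real_def)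
  qed
qed

text \<open>A future signal in mode \<open>j\<close> is not itself admissible for mode \<open>i\<close>, since time \<open>0\<close> is no
  switching instant. It becomes admissible after a short delay \<open>h\<close> in mode \<open>i\<close>, at the price of
  replacing \<open>x\<close> by \<open>S i h x\<close>.\<close>

lemma V_jump:
  assumes "j \<noteq> i"
  shows "V j 0 x \<le> V i T x"
proof (rule field_le_epsilon)
  fix \<epsilon> :: real assume "0 < \<epsilon>"
  then obtain \<delta> where \<delta>: "0 < \<delta>"
    "\<And>j \<sigma> h. 0 \<le> h \<Longrightarrow> h < \<delta> \<Longrightarrow> V j \<sigma> x \<le> V j \<sigma> (S i h x) + \<epsilon>"
    using V_near_start[of \<epsilon> x i] by auto
  have "0 * (\<delta> / 2) + V j 0 (S i (\<delta> / 2) x) \<le> V i T x" using \<delta>(1) assms by (intro V_step) auto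
  then show "V j 0 x \<le> V i T x + \<epsilon>" using \<delta>(2)[of "\<delta> / 2" j 0] \<delta>(1) by simp
qed

lemma V_dini:
  assumes "0 \<le> \<tau>" "\<tau> \<le> T"
  shows "lower_dini (S i) (timer_extend T (V i)) \<tau> x \<le> ereal (- (norm x powr p))"
proof (rule ereal_le_epsilon2)
  fix \<epsilon> :: real assume "0 < \<epsilon>"
  \<comment> \<open>As a lower bound of a cost rate, \<open>m\<close> must be nonnegative also when \<open>\<epsilon>\<close> is large.\<close>
  define m where "m = max 0 (norm x powr p - \<epsilon>)"
  have "((\<lambda>s. norm (S i s x) powr p) \<longlongrightarrow> norm x powr p) (at_right 0)"
    using p_ge_1 by (intro tendsto_powr' tendsto_norm orbit_tendsto tendsto_const) auto
  then have "\<forall>\<^sub>F s in at_right 0. norm x powr p - \<epsilon> < norm (S i s x) powr p"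
    using \<open>0 < \<epsilon>\<close> by (intro order_tendstoD(1)) auto
  then obtain \<delta> where \<delta>: "0 < \<delta>" "\<And>s. 0 < s \<Longrightarrow> s < \<delta> \<Longrightarrow> norm x powr p - \<epsilon> < norm (S i s x) powr p"
    by (auto simp: eventually_at_right_field)
  have m: "m \<le> norm (S i s x) powr p" if "0 \<le> s" "s < \<delta>" for s
    using \<delta>(2)[of s] that \<open>0 < \<epsilon>\<close> by (cases "s = 0") (auto simp: m_def)
  have "\<forall>\<^sub>F h in at_right 0. h \<in> {0<..<\<delta>}"
    using \<delta>(1) by (intro eventually_at_rightI[of _ \<delta>]) auto
  then have "\<forall>\<^sub>F h in at_right 0. ereal ((timer_extend T (V i) (\<tau> + h) (S i h x) -
      timer_extend T (V i) \<tau> x) / h) \<le> ereal (- (norm x powr p - \<epsilon>))"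
  proof eventually_elim
    case (elim h)
    have "m * h + V i (\<tau> + h) (S i h x) \<le> V i \<tau> x"
      using elim m by (intro V_step) (auto simp: m_def)
    then have "(V i (\<tau> + h) (S i h x) - V i \<tau> x) / h \<le> - m"
      using elim by (simp add: field_simps)
    also have "\<dots> \<le> - (norm x powr p - \<epsilon>)" by (simp add: m_def)
    finally show ?case by (simp add: timer_extend_def W_min)
  qed
  then have "lower_dini (S i) (timer_extend T (V i)) \<tau> x \<le> ereal (- (norm x powr p - \<epsilon>))"
    unfolding lower_dini_def by (intro Liminf_le) auto
  then show "lower_dini (S i) (timer_extend T (V i)) \<tau> x \<le> ereal (- (norm x powr p)) + ereal \<epsilon>"
    by simp
qed

lemma witness_is_timer_functional:
  "timer_functionals S T p (K powr p / (\<beta> * p)) V"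
  unfolding timer_functionals_def
proof (intro conjI allI ballI impI)
  fix i :: 'n and \<tau> :: real and x :: 'a
  show "V i \<tau> x \<le> K powr p / (\<beta> * p) * norm x powr p"
    using W_bound[of i \<tau> x] \<beta>_pos p_ge_1 by (intro enn2real_leI) auto
next
  fix i :: 'n and r :: real assume "0 < r"
  let ?L = "K powr p * r powr (p - 1) / \<beta>"
  show "\<exists>L>0. \<forall>\<tau>\<in>{0..T}. \<forall>x y. norm x < r \<and> norm y < r \<longrightarrow> \<bar>V i \<tau> x - V i \<tau> y\<bar> \<le> L * norm (x - y)"
  proof (intro exI[of _ ?L] conjI ballI allI impI)
    show "0 < ?L" using \<open>0 < r\<close> \<beta>_pos K_ge_1 by simp
    fix \<tau> and x y :: 'a assume "norm x < r \<and> norm y < r"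
    then show "\<bar>V i \<tau> x - V i \<tau> y\<bar> \<le> ?L * norm (x - y)"
      using V_lipschitz[of x r y i \<tau>] V_lipschitz[of y r x i \<tau>] by (simp add: norm_minus_commute abs_le_iff)
  qed
qed (use V_continuous V_jump V_dini in auto)

end

section \<open>The equivalence\<close>

lemma uniform_decay_constants:
  fixes S :: "'n::finite \<Rightarrow> real \<Rightarrow> 'a::banach \<Rightarrow>\<^sub>L 'a"
  assumes "\<And>i. exponentially_stable (S i)"
  obtains M \<omega> where "1 \<le> M" "0 < \<omega>" "\<And>i t. 0 \<le> t \<Longrightarrow> norm (S i t) \<le> M * exp (- \<omega> * t)"
proof -
  have "\<forall>i. \<exists>M \<omega>. 1 \<le> M \<and> 0 < \<omega> \<and> (\<forall>t\<ge>0. norm (S i t) \<le> M * exp (- \<omega> * t))"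
    using assms unfolding exponentially_stable_def by blast
  then obtain M \<omega> where M: "\<And>i. 1 \<le> M i" and \<omega>: "\<And>i. 0 < \<omega> i"
    and le: "\<And>i t. 0 \<le> t \<Longrightarrow> norm (S i t) \<le> M i * exp (- \<omega> i * t)"
    by metis
  show ?thesis
  proof (rule that[of "Max (range M)" "Min (range \<omega>)"])
    show "1 \<le> Max (range M)" using M by (subst Max_ge_iff) auto
    show "0 < Min (range \<omega>)" using \<omega> by (subst Min_gr_iff) auto
    fix i and t :: real assume "0 \<le> t"
    have "M i \<le> Max (range M)" by simp
    have "Min (range \<omega>) * t \<le> \<omega> i * t" using \<open>0 \<le> t\<close> by (intro mult_right_mono) simp_all
    have "norm (S i t) \<le> M i * exp (- \<omega> i * t)" using le[OF \<open>0 \<le> t\<close>] .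
    also have "\<dots> \<le> Max (range M) * exp (- Min (range \<omega>) * t)"
    proof (rule mult_mono)
      show "exp (- \<omega> i * t) \<le> exp (- Min (range \<omega>) * t)"
        using \<open>Min (range \<omega>) * t \<le> \<omega> i * t\<close> by (simp only: exp_le_cancel_iff mult_minus_left neg_le_iff_le)
      show "0 \<le> Max (range M)" using M[of i] \<open>M i \<le> Max (range M)\<close> by linarith
    qed (use \<open>M i \<le> Max (range M)\<close> in simp_all)
    finally show "norm (S i t) \<le> Max (range M) * exp (- Min (range \<omega>) * t)" .
  qed
qed

lemma (in stable_modes) witness_if_UES:
  assumes UES and "1 \<le> p"
  shows "witness_functional S T p i \<tau> x < \<infinity>"
    and "\<exists>c>0. timer_functionals S T p c (\<lambda>i \<tau> x. enn2real (witness_functional S T p i \<tau> x))"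
proof -
  obtain K \<beta> where K: "1 \<le> K" and \<beta>: "0 < \<beta>"
    and bound: "\<forall>\<eta>\<in>Sigma_min T. \<forall>s t. 0 \<le> s \<and> s \<le> t \<longrightarrow>
      norm (evolution S \<eta> t s) \<le> K * exp (- \<beta> * (t - s))"
    using \<open>UES\<close> unfolding UES_def by blast
  interpret exponentially_stable_switching S T M \<omega> K \<beta> p
  proof unfold_locales
    show "norm (evolution S \<eta> t 0) \<le> K * exp (- \<beta> * t)" if "\<eta> \<in> Sigma_min T" "0 \<le> t" for \<eta> t
      using bound[rule_format, OF that(1), of 0 t] that(2) by simp
  qed (use K \<beta> \<open>1 \<le> p\<close> in auto)
  show "witness_functional S T p i \<tau> x < \<infinity>" by (rule W_finite)
  have "0 < K powr p / (\<beta> * p)" using K \<beta> \<open>1 \<le> p\<close> by simp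
  then show "\<exists>c>0. timer_functionals S T p c (\<lambda>i \<tau> x. enn2real (witness_functional S T p i \<tau> x))"
    using witness_is_timer_functional by blast
qed

theorem theorem7p4:
  fixes A :: "'n::finite \<Rightarrow> 'a::banach \<Rightarrow> 'a"
    and D :: "'a set"
    and S :: "'n \<Rightarrow> real \<Rightarrow> 'a \<Rightarrow>\<^sub>L 'a"
    and T_min q :: real
  assumes "\<And>i. generates D (A i) (S i)"
    and "T_min > 0"
    and "\<And>i. exponentially_stable (S i)"
    and "q \<ge> 1"
    and "lifted_growth q S (Sigma_min T_min)"
  shows "(UGES S (Sigma_min T_min) \<longleftrightarrow>
            (\<exists>p\<ge>1. \<exists>c>0. \<exists>V. timer_functionals S T_min p c V)) \<and>
         (UGES S (Sigma_min T_min) \<longrightarrow>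
            (\<forall>p\<ge>1. (\<forall>i. \<forall>\<tau>\<ge>0. \<forall>x. witness_functional S T_min p i \<tau> x < \<infinity>) \<and>
               (\<forall>i. \<forall>\<tau>\<ge>T_min. \<forall>x. witness_functional S T_min p i \<tau> x
                                    = witness_functional S T_min p i T_min x) \<and>
               (\<exists>c>0. timer_functionals S T_min p c
                   (\<lambda>i \<tau> x. enn2real (witness_functional S T_min p i \<tau> x)))))"
proof -
  have semigroup: "C0_semigroup (S i)" for i using assms(1) by (simp add: generates_def)
  obtain M \<omega> where "1 \<le> M" "0 < \<omega>" "\<And>i t. 0 \<le> t \<Longrightarrow> norm (S i t) \<le> M * exp (- \<omega> * t)"
    using uniform_decay_constants[of S] assms(3) by blast
  then interpret stable_modes S T_min M \<omega>
    by unfold_locales (use semigroup assms(2) in auto)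
  have UGES_iff: "UGES S (Sigma_min T_min) \<longleftrightarrow> UES" using UES_if_UGES UGES_if_UES by blast
  have saturated: "witness_functional S T_min p i \<tau> x = witness_functional S T_min p i T_min x"
    if "T_min \<le> \<tau>" for p i \<tau> x
    using that Sigma_future_min[of T_min i \<tau>] by (simp add: witness_functional_def min_absorb2)
  have "\<exists>p\<ge>1. \<exists>c>0. \<exists>V. timer_functionals S T_min p c V" if UES
    using witness_if_UES(2)[OF that order_refl] by (intro exI[of _ 1]) auto
  then have equiv: "UES \<longleftrightarrow> (\<exists>p\<ge>1. \<exists>c>0. \<exists>V. timer_functionals S T_min p c V)"
    using UES_if_timer_functionals by blast
  show ?thesis
    unfolding UGES_iff by (intro conjI impI allI equiv witness_if_UES saturated)
qed

end
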